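(* Let $\Pi$ be a finite set of proposition symbols and $\Delta\in\mathbb{N}$. Given a message passing circuit (MPC) $C$ for $(\Pi,\Delta)$, one can construct a $\Pi$-program of $\mathrm{MSC}$ that is equivalent to $C$. Moreover, for any constant bound $c$ on the fan-in of MPCs (i.e. considering only MPCs all of whose gates have fan-in at most $c$), the size of the constructed program is linear in the size of the circuit. The computation time of the program is $\mathcal{O}(d+2^{|\Pi_1|})$ times the computation time of the MPC, where $d$ is the depth of $C$.
   Context: Proposition symbols: there is a countably infinite, linearly ordered set of proposition symbols partitioned into ordinary symbols and identifier symbols. For a finite set $\Pi$ of proposition symbols, $\Pi_0$ denotes its ordinary and $\Pi_1$ its identifier symbols. A Kripke model over $\Pi$ is $M=(W,R,V)$ with $W\neq\emptyset$, $R\subseteq W\times W$, $V:\Pi\to\mathcal P(W)$; $\mathrm{succ}(w)=\{v:(w,v)\in R\}$. If $p_1,\dots,p_\ell$ list $\Pi_1$ in order, $\mathrm{ID}(w)$ is the $\ell$-bit string whose $i$th bit is $1$ iff $w\in V(p_i)$; $M$ has identifiers if $\mathrm{ID}$ is injective. The local input of $w$ is the $|\Pi|$-bit string whose $i$th bit is $1$ iff $w$ satisfies the $i$th symbol of $\Pi$ (in the order). $\mathcal K(\Pi,\Delta)$ is the class of finite Kripke models over $\Pi$ with identifiers in which every node has out-degree at most $\Delta$. If the successors of $w$ have identifiers $s_1<\dots<s_d$ (lexicographic order), the successor with identifier $s_i$ is the $i$th neighbour of $w$. Acceptance of sequences: given a sequence $(\overline b_n)_{n\in\mathbb N}$ of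 $k$-bit strings and sets $A,P\subseteq[k]$ (attention and print positions), the sequence accepts in round $n$ if some position in $A$ of $\overline b_n$ is $1$ and all positions in $A$ of $\overline b_m$ are $0$ for all $m<n$; it then outputs the substring of $\overline b_n$ at the positions in $P$. Circuits: a Boolean circuit is a DAG whose nodes (gates) of nonzero in-degree are labelled $\wedge,\vee$ (any fan-in) or $\neg$ (fan-in 1); zero fan-in gates are input gates, zero fan-out gates are output gates, both linearly ordered; size = number of gates, depth = longest path length from an input to an output gate. A message passing circuit (MPC) for $(\Pi,\Delta)$ is a circuit computing a function $\{0,1\}^{|\Pi|+k(\Delta+1)}\to\{0,1\}^k$ (some $k$, the state length) together with sets $A,P\subseteq[k]$ of attention and print bits. On $M=(W,R,V)\in\mathcal K(\Pi,\Delta)$ it computes states $f_n(w)\in\{0,1\}^k$: $f_0(w)$ is the output of $C$ on $\overline t_w\cdot0^{k(\Delta+1)}$ where $\overline t_w$ is the local input; $f_{n+1}(w)$ is the output of $C$ on $\overline t_w\cdot f_n(w)\cdot f_n(v_1)\cdots f_n(v_m)\cdot(0^k)^{\Delta-m}$ where $v_1,\dots,v_m$ are the neighbours of $w$ in order. Node $w$ accepts/outputs in round $n$ if $(f_n(w))_n$ does so w.r.t. $(k,A,P)$; the round in which it outputs is the computation time at $w$. MSC: formulas of $\mathrm{ML}(\Pi)$ are given by $\varphi::=\top\mid p\mid\neg\varphi\mid(\varphi\wedge\varphi)\mid\Diamond\varphi$ ($p\in\Pi$), with the usual semantics ($\Diamond\varphi$ holds at $w$ iff $\varphi$ holds at some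 $v\in\mathrm{succ}(w)$). Schemata over a set $\mathcal T$ of schema variables additionally allow variables from $\mathcal T$. A $\Pi$-program of MSC has distinct head predicates (schema variables) $Y_1,\dots,Y_k$ (in a fixed order), for each $i$ a terminal clause $Y_i(0):=\varphi_i$ with $\varphi_i\in\mathrm{ML}(\Pi)$ and an iteration clause $Y_i:=\psi_i$ with $\psi_i$ a schema over $\{Y_1,\dots,Y_k\}$, and sets of attention and print predicates among the heads. Iteration formulas: $Y_i^0=\varphi_i$, and $Y_i^{n+1}$ is $\psi_i$ with every $Y_j$ replaced by $Y_j^n$. At node $w$ the round-$n$ configuration is the $k$-bit string whose $i$th bit is $1$ iff $(M,w)\models Y_i^n$; $w$ accepts/outputs in round $n$ if this sequence does so w.r.t. the positions of attention and print predicates; that round is the computation time. The size of a program is the number of occurrences of proposition symbols, head predicates, $\top,\neg,\wedge$ and diamonds. Equivalence: a program and an MPC $C$ for $(\Pi,\Delta)$ are equivalent if for every Kripke model $M\in\mathcal K(\Pi,\Delta)$ interpreting all proposition symbols of the program and every node $w$ of $M$, both produce the same output at $w$ or neither produces any output at $w$.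
   Formalization: Rounds are numbered from 0, so the time bound uses max(1, n) for MPC computation time n: the literal bound at n = 0 contradicts linear size (parity circuits). Nodes of models come from one fixed set; the natural numbers cover all finite models up to isomorphism. *)

theory Defs
  imports Main "HOL-Library.Infinite_Typeclass" "HOL-Library.Countable" "HOL-Library.List_Lexorder"
begin

section \<open>Kripke models with identifiers\<close>

text \<open>
  Proposition symbols form a linearly ordered type \<open>'p\<close>. The partition into ordinary and
  identifier symbols is given by the set \<open>Idn\<close> of identifier symbols, so that
  \<open>\<Pi> - Idn\<close> is \<open>\<Pi>\<^sub>0\<close> and \<open>\<Pi> \<inter> Idn\<close> is \<open>\<Pi>\<^sub>1\<close>. Bit strings are lists of booleans, the bit 1
  being \<open>True\<close>; \<open><\<close> on lists is the lexicographic order. Bit positions are counted from 0.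
\<close>

record ('p, 'w) kripke =
  worlds :: "'w set"
  acc :: "('w \<times> 'w) set"
  val :: "'p \<Rightarrow> 'w set"

definition kripke_model :: "'p set \<Rightarrow> ('p, 'w) kripke \<Rightarrow> bool" where
  "kripke_model \<Pi> M \<longleftrightarrow>
     worlds M \<noteq> {} \<and> acc M \<subseteq> worlds M \<times> worlds M \<and> (\<forall>p\<in>\<Pi>. val M p \<subseteq> worlds M)"

definition succ :: "('p, 'w) kripke \<Rightarrow> 'w \<Rightarrow> 'w set" where
  "succ M w = {v. (w, v) \<in> acc M}"

definition bits_at :: "('p::linorder, 'w) kripke \<Rightarrow> 'p set \<Rightarrow> 'w \<Rightarrow> bool list" where
  "bits_at M \<Pi> w = map (\<lambda>p. w \<in> val M p) (sorted_list_of_set \<Pi>)"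

definition local_input :: "'p::linorder set \<Rightarrow> ('p, 'w) kripke \<Rightarrow> 'w \<Rightarrow> bool list" where
  "local_input \<Pi> M w = bits_at M \<Pi> w"

definition ID :: "'p::linorder set \<Rightarrow> 'p set \<Rightarrow> ('p, 'w) kripke \<Rightarrow> 'w \<Rightarrow> bool list" where
  "ID Idn \<Pi> M w = bits_at M (\<Pi> \<inter> Idn) w"

definition has_identifiers :: "'p::linorder set \<Rightarrow> 'p set \<Rightarrow> ('p, 'w) kripke \<Rightarrow> bool" where
  "has_identifiers Idn \<Pi> M \<longleftrightarrow> inj_on (ID Idn \<Pi> M) (worlds M)"

definition model_class :: "'p::linorder set \<Rightarrow> 'p set \<Rightarrow> nat \<Rightarrow> ('p, 'w) kripke set" where
  "model_class Idn \<Pi> \<Delta> =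
     {M. kripke_model \<Pi> M \<and> finite (worlds M) \<and> has_identifiers Idn \<Pi> M \<and>
         (\<forall>w\<in>worlds M. card (succ M w) \<le> \<Delta>)}"

definition neighbours :: "'p::linorder set \<Rightarrow> 'p set \<Rightarrow> ('p, 'w) kripke \<Rightarrow> 'w \<Rightarrow> 'w list" where
  "neighbours Idn \<Pi> M w =
     map (inv_into (succ M w) (ID Idn \<Pi> M)) (sorted_list_of_set (ID Idn \<Pi> M ` succ M w))"


section \<open>Acceptance and output of sequences of bit strings\<close>

definition accepts_in :: "nat set \<Rightarrow> (nat \<Rightarrow> bool list) \<Rightarrow> nat \<Rightarrow> bool" where
  "accepts_in A b n \<longleftrightarrow> (\<exists>i\<in>A. b n ! i) \<and> (\<forall>m<n. \<forall>i\<in>A. \<not> b m ! i)"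

definition output_of :: "nat set \<Rightarrow> nat set \<Rightarrow> (nat \<Rightarrow> bool list) \<Rightarrow> bool list option" where
  "output_of A P b =
     (if \<exists>n. accepts_in A b n then Some (nths (b (THE n. accepts_in A b n)) P) else None)"


section \<open>Boolean circuits\<close>

datatype gate_label = AndG | OrG | NotG

text \<open>
  A wire \<open>(h, g)\<close> leads from \<open>h\<close> to \<open>g\<close>. The lists \<open>inputs\<close> and \<open>outputs\<close> carry the linear
  orders of the input and output gates. Labels of input gates are irrelevant.
\<close>

record 'g circuit =
  gates :: "'g set"
  wires :: "('g \<times> 'g) set"
  label :: "'g \<Rightarrow> gate_label"
  inputs :: "'g list"
  outputs :: "'g list"

definition fan_in :: "'g circuit \<Rightarrow> 'g \<Rightarrow> nat" where
  "fan_in C g = card {h. (h, g) \<in> wires C}"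

definition fan_out :: "'g circuit \<Rightarrow> 'g \<Rightarrow> nat" where
  "fan_out C g = card {h. (g, h) \<in> wires C}"

definition boolean_circuit :: "'g circuit \<Rightarrow> bool" where
  "boolean_circuit C \<longleftrightarrow>
     finite (gates C) \<and> wires C \<subseteq> gates C \<times> gates C \<and> acyclic (wires C) \<and>
     distinct (inputs C) \<and> set (inputs C) = {g \<in> gates C. fan_in C g = 0} \<and>
     distinct (outputs C) \<and> set (outputs C) = {g \<in> gates C. fan_out C g = 0} \<and>
     (\<forall>g\<in>gates C. fan_in C g \<noteq> 0 \<longrightarrow> label C g = NotG \<longrightarrow> fan_in C g = 1)"

definition circuit_size :: "'g circuit \<Rightarrow> nat" where
  "circuit_size C = card (gates C)"

text \<open>\<open>Sup\<close> is the maximum of a finite nonempty set of naturals and 0 on the empty set.\<close>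

definition circuit_depth :: "'g circuit \<Rightarrow> nat" where
  "circuit_depth C =
     Sup {n. \<exists>g\<in>set (inputs C). \<exists>h\<in>set (outputs C). (g, h) \<in> wires C ^^ n}"

definition fan_in_bounded :: "nat \<Rightarrow> 'g circuit \<Rightarrow> bool" where
  "fan_in_bounded c C \<longleftrightarrow> (\<forall>g\<in>gates C. fan_in C g \<le> c)"

definition gate_value :: "'g circuit \<Rightarrow> bool list \<Rightarrow> 'g \<Rightarrow> bool" where
  "gate_value C x = wfrec (wires C) (\<lambda>value g.
     if \<exists>h. (h, g) \<in> wires C then
       (case label C g of
          AndG \<Rightarrow> \<forall>h. (h, g) \<in> wires C \<longrightarrow> value h
        | OrG \<Rightarrow> \<exists>h. (h, g) \<in> wires C \<and> value h
        | NotG \<Rightarrow> \<exists>h. (h, g) \<in> wires C \<and> \<not> value h)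
     else the (map_of (zip (inputs C) x) g))"

lemma gate_value_rec:
  assumes "boolean_circuit C"
  shows "gate_value C x g =
    (if \<exists>h. (h, g) \<in> wires C then
       (case label C g of
          AndG \<Rightarrow> \<forall>h. (h, g) \<in> wires C \<longrightarrow> gate_value C x h
        | OrG \<Rightarrow> \<exists>h. (h, g) \<in> wires C \<and> gate_value C x h
        | NotG \<Rightarrow> \<exists>h. (h, g) \<in> wires C \<and> \<not> gate_value C x h)
     else the (map_of (zip (inputs C) x) g))"
proof -
  have "finite (wires C)"
    using assms unfolding boolean_circuit_def by (meson finite_SigmaI finite_subset)
  then have "wf (wires C)"
    using assms unfolding boolean_circuit_def by (blast intro: finite_acyclic_wf)
  then show ?thesis
    unfolding gate_value_def by (subst wfrec) (auto simp: cut_def split: gate_label.split)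
qed

definition circuit_fun :: "'g circuit \<Rightarrow> bool list \<Rightarrow> bool list" where
  "circuit_fun C x = map (gate_value C x) (outputs C)"


section \<open>Message passing circuits\<close>

record 'g mpc =
  circ :: "'g circuit"
  attention_bits :: "nat set"
  print_bits :: "nat set"

definition state_length :: "'g mpc \<Rightarrow> nat" where
  "state_length C = length (outputs (circ C))"

definition is_mpc :: "'p set \<Rightarrow> nat \<Rightarrow> 'g mpc \<Rightarrow> bool" where
  "is_mpc \<Pi> \<Delta> C \<longleftrightarrow>
     boolean_circuit (circ C) \<and>
     length (inputs (circ C)) = card \<Pi> + state_length C * (\<Delta> + 1) \<and>
     attention_bits C \<subseteq> {..<state_length C} \<and> print_bits C \<subseteq> {..<state_length C}"

primrec mpc_state ::
  "'p::linorder set \<Rightarrow> 'p set \<Rightarrow> nat \<Rightarrow> 'g mpc \<Rightarrow> ('p, 'w) kripke \<Rightarrow> nat \<Rightarrow> 'w \<Rightarrow> bool list" where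
  "mpc_state Idn \<Pi> \<Delta> C M 0 w =
     circuit_fun (circ C)
       (local_input \<Pi> M w @ replicate (state_length C * (\<Delta> + 1)) False)"
| "mpc_state Idn \<Pi> \<Delta> C M (Suc n) w =
     circuit_fun (circ C)
       (local_input \<Pi> M w @ mpc_state Idn \<Pi> \<Delta> C M n w @
        concat (map (mpc_state Idn \<Pi> \<Delta> C M n) (neighbours Idn \<Pi> M w)) @
        replicate (state_length C * (\<Delta> - length (neighbours Idn \<Pi> M w))) False)"

definition mpc_accepts_in ::
  "'p::linorder set \<Rightarrow> 'p set \<Rightarrow> nat \<Rightarrow> 'g mpc \<Rightarrow> ('p, 'w) kripke \<Rightarrow> 'w \<Rightarrow> nat \<Rightarrow> bool" where
  "mpc_accepts_in Idn \<Pi> \<Delta> C M w n \<longleftrightarrow>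
     accepts_in (attention_bits C) (\<lambda>m. mpc_state Idn \<Pi> \<Delta> C M m w) n"

definition mpc_output ::
  "'p::linorder set \<Rightarrow> 'p set \<Rightarrow> nat \<Rightarrow> 'g mpc \<Rightarrow> ('p, 'w) kripke \<Rightarrow> 'w \<Rightarrow> bool list option" where
  "mpc_output Idn \<Pi> \<Delta> C M w =
     output_of (attention_bits C) (print_bits C) (\<lambda>m. mpc_state Idn \<Pi> \<Delta> C M m w)"


section \<open>Modal substitution calculus\<close>

datatype (props: 'p, svars: 'v) schema =
    Top
  | Prop 'p
  | SVar 'v
  | Neg "('p, 'v) schema"
  | Conj "('p, 'v) schema" "('p, 'v) schema"
  | Dia "('p, 'v) schema"

definition schemata :: "'p set \<Rightarrow> 'v set \<Rightarrow> ('p, 'v) schema set" where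
  "schemata \<Pi> T = {\<psi>. props \<psi> \<subseteq> \<Pi> \<and> svars \<psi> \<subseteq> T}"

definition modal_formulas :: "'p set \<Rightarrow> ('p, 'v) schema set" where
  "modal_formulas \<Pi> = schemata \<Pi> {}"

text \<open>The clause for schema variables is a dummy: only variable-free schemata are evaluated.\<close>

primrec sat :: "('p, 'w) kripke \<Rightarrow> 'w \<Rightarrow> ('p, 'v) schema \<Rightarrow> bool" where
  "sat M w Top = True"
| "sat M w (Prop p) = (w \<in> val M p)"
| "sat M w (SVar X) = False"
| "sat M w (Neg \<phi>) = (\<not> sat M w \<phi>)"
| "sat M w (Conj \<phi> \<psi>) = (sat M w \<phi> \<and> sat M w \<psi>)"
| "sat M w (Dia \<phi>) = (\<exists>v\<in>succ M w. sat M v \<phi>)"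

primrec schema_subst :: "('v \<Rightarrow> ('p, 'v) schema) \<Rightarrow> ('p, 'v) schema \<Rightarrow> ('p, 'v) schema" where
  "schema_subst \<sigma> Top = Top"
| "schema_subst \<sigma> (Prop p) = Prop p"
| "schema_subst \<sigma> (SVar X) = \<sigma> X"
| "schema_subst \<sigma> (Neg \<phi>) = Neg (schema_subst \<sigma> \<phi>)"
| "schema_subst \<sigma> (Conj \<phi> \<psi>) = Conj (schema_subst \<sigma> \<phi>) (schema_subst \<sigma> \<psi>)"
| "schema_subst \<sigma> (Dia \<phi>) = Dia (schema_subst \<sigma> \<phi>)"

primrec schema_size :: "('p, 'v) schema \<Rightarrow> nat" where
  "schema_size Top = 1"
| "schema_size (Prop p) = 1"
| "schema_size (SVar X) = 1"
| "schema_size (Neg \<phi>) = Suc (schema_size \<phi>)"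
| "schema_size (Conj \<phi> \<psi>) = Suc (schema_size \<phi> + schema_size \<psi>)"
| "schema_size (Dia \<phi>) = Suc (schema_size \<phi>)"

text \<open>
  Schema variables are natural numbers. The order of the head predicates is their order in the
  list \<open>heads\<close>; the values of \<open>terminal\<close> and \<open>iteration\<close> outside the heads are irrelevant.
\<close>

record 'p program =
  heads :: "nat list"
  terminal :: "nat \<Rightarrow> ('p, nat) schema"
  iteration :: "nat \<Rightarrow> ('p, nat) schema"
  attention_preds :: "nat set"
  print_preds :: "nat set"

definition msc_program :: "'p set \<Rightarrow> 'p program \<Rightarrow> bool" where
  "msc_program \<Pi> \<Gamma> \<longleftrightarrow>
     distinct (heads \<Gamma>) \<and>
     (\<forall>Y\<in>set (heads \<Gamma>). terminal \<Gamma> Y \<in> modal_formulas \<Pi> \<and> iteration \<Gamma> Y \<in> schemata \<Pi> (set (heads \<Gamma>))) \<and>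
     attention_preds \<Gamma> \<subseteq> set (heads \<Gamma>) \<and> print_preds \<Gamma> \<subseteq> set (heads \<Gamma>)"

text \<open>The summand 2 counts the occurrences of the head predicate on the left of its two clauses.\<close>

definition program_size :: "'p program \<Rightarrow> nat" where
  "program_size \<Gamma> =
     (\<Sum>Y\<leftarrow>heads \<Gamma>. 2 + schema_size (terminal \<Gamma> Y) + schema_size (iteration \<Gamma> Y))"

primrec iteration_formula :: "'p program \<Rightarrow> nat \<Rightarrow> nat \<Rightarrow> ('p, nat) schema" where
  "iteration_formula \<Gamma> 0 Y = terminal \<Gamma> Y"
| "iteration_formula \<Gamma> (Suc n) Y = schema_subst (iteration_formula \<Gamma> n) (iteration \<Gamma> Y)"

definition configuration :: "'p program \<Rightarrow> ('p, 'w) kripke \<Rightarrow> 'w \<Rightarrow> nat \<Rightarrow> bool list" where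
  "configuration \<Gamma> M w n = map (\<lambda>Y. sat M w (iteration_formula \<Gamma> n Y)) (heads \<Gamma>)"

definition head_positions :: "'p program \<Rightarrow> nat set \<Rightarrow> nat set" where
  "head_positions \<Gamma> S = {i. i < length (heads \<Gamma>) \<and> heads \<Gamma> ! i \<in> S}"

definition program_accepts_in :: "'p program \<Rightarrow> ('p, 'w) kripke \<Rightarrow> 'w \<Rightarrow> nat \<Rightarrow> bool" where
  "program_accepts_in \<Gamma> M w n \<longleftrightarrow>
     accepts_in (head_positions \<Gamma> (attention_preds \<Gamma>)) (configuration \<Gamma> M w) n"

definition program_output :: "'p program \<Rightarrow> ('p, 'w) kripke \<Rightarrow> 'w \<Rightarrow> bool list option" where
  "program_output \<Gamma> M w =
     output_of (head_positions \<Gamma> (attention_preds \<Gamma>)) (head_positions \<Gamma> (print_preds \<Gamma>))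
       (configuration \<Gamma> M w)"


section \<open>Equivalence\<close>

text \<open>
  The type argument names the type from which the nodes of the models are drawn; over an infinite
  type all finite models occur up to isomorphism.
\<close>

definition equivalent ::
  "'w itself \<Rightarrow> 'p::linorder set \<Rightarrow> 'p set \<Rightarrow> nat \<Rightarrow> 'g mpc \<Rightarrow> 'p program \<Rightarrow> bool" where
  "equivalent (_ :: 'w itself) Idn \<Pi> \<Delta> C \<Gamma> \<longleftrightarrow>
     (\<forall>M :: ('p, 'w) kripke. M \<in> model_class Idn \<Pi> \<Delta> \<longrightarrow>
        (\<forall>w\<in>worlds M. program_output \<Gamma> M w = mpc_output Idn \<Pi> \<Delta> C M w))"

end

theory Submission
  imports Defs
begin

text \<open>
  The program simulates one round of the circuit in a phase of length \<open>O(d + 2^|\<Pi>\<^sub>1|)\<close>. All nodes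
  run the same binary counter through the identifiers in descending order; when the counter shows
  its identifier, a node announces itself, and every predecessor reads the announced state through
  a diamond and pushes it into a shift register, which therefore ends up ordered by ascending
  identifiers. The gates are recomputed in every round, so \<open>d + 1\<close> rounds later they
  carry the values of the circuit and the next state is read off from the output gates. A counter
  of linear size cannot be incremented in one round if each carry has to pass through all bits, so
  the carries (and the comparison with the identifier) are pipelined: every stage works on the
  number that the previous stage worked on one round earlier.
\<close>

section \<open>Evaluation of schemata in an environment, and derived connectives\<close>

primrec holds :: "('p, 'w) kripke \<Rightarrow> ('w \<Rightarrow> 'v \<Rightarrow> bool) \<Rightarrow> 'w \<Rightarrow> ('p, 'v) schema \<Rightarrow> bool" where
  "holds M E w Top = True"
| "holds M E w (Prop p) = (w \<in> val M p)"
| "holds M E w (SVar X) = E w X"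
| "holds M E w (Neg \<phi>) = (\<not> holds M E w \<phi>)"
| "holds M E w (Conj \<phi> \<psi>) = (holds M E w \<phi> \<and> holds M E w \<psi>)"
| "holds M E w (Dia \<phi>) = (\<exists>v\<in>succ M w. holds M E v \<phi>)"

text \<open>Substitution lemma: a round of a program amounts to evaluating its iteration clauses in
  the environment given by the previous round. Environments depend on the node because diamonds move
  to successors.\<close>

lemma sat_schema_subst:
  "sat M w (schema_subst \<sigma> \<psi>) = holds M (\<lambda>v Y. sat M v (\<sigma> Y)) w \<psi>"
  by (induction \<psi> arbitrary: w) auto

lemma holds_map_schema:
  "holds M E w (map_schema id f \<psi>) = holds M (\<lambda>v r. E v (f r)) w \<psi>"
  by (induction \<psi> arbitrary: w) auto

lemma holds_cong:
  "(\<And>v r. r \<in> svars \<psi> \<Longrightarrow> E v r = E' v r) \<Longrightarrow> holds M E w \<psi> = holds M E' w \<psi>"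
  by (induction \<psi> arbitrary: w) auto

lemma schema_size_map_schema: "schema_size (map_schema f g \<psi>) = schema_size \<psi>"
  by (induction \<psi>) auto

definition Disj :: "('p, 'v) schema \<Rightarrow> ('p, 'v) schema \<Rightarrow> ('p, 'v) schema" where
  "Disj a b = Neg (Conj (Neg a) (Neg b))"

definition Ite :: "('p, 'v) schema \<Rightarrow> ('p, 'v) schema \<Rightarrow> ('p, 'v) schema \<Rightarrow> ('p, 'v) schema" where
  "Ite c a b = Disj (Conj c a) (Conj (Neg c) b)"

definition Xor :: "('p, 'v) schema \<Rightarrow> ('p, 'v) schema \<Rightarrow> ('p, 'v) schema" where
  "Xor a b = Ite a (Neg b) b"

definition Conjs :: "('p, 'v) schema list \<Rightarrow> ('p, 'v) schema" where
  "Conjs \<phi>s = foldr Conj \<phi>s Top"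

lemma holds_connectives [simp]:
  "holds M E w (Disj a b) \<longleftrightarrow> holds M E w a \<or> holds M E w b"
  "holds M E w (Ite c a b) \<longleftrightarrow> (if holds M E w c then holds M E w a else holds M E w b)"
  "holds M E w (Xor a b) \<longleftrightarrow> holds M E w a \<noteq> holds M E w b"
  "holds M E w (Conjs \<phi>s) \<longleftrightarrow> (\<forall>\<phi>\<in>set \<phi>s. holds M E w \<phi>)"
  by (auto simp: Disj_def Ite_def Xor_def Conjs_def) (induction \<phi>s; auto)+

lemma symbols_connectives [simp]:
  "props (Disj a b) = props a \<union> props b" "svars (Disj a b) = svars a \<union> svars b"
  "props (Ite c a b) = props c \<union> props a \<union> props b"
  "svars (Ite c a b) = svars c \<union> svars a \<union> svars b"
  "props (Xor a b) = props a \<union> props b" "svars (Xor a b) = svars a \<union> svars b"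
  "props (Conjs \<phi>s) = (\<Union>\<phi>\<in>set \<phi>s. props \<phi>)" "svars (Conjs \<phi>s) = (\<Union>\<phi>\<in>set \<phi>s. svars \<phi>)"
proof -
  show "props (Conjs \<phi>s) = (\<Union>\<phi>\<in>set \<phi>s. props \<phi>)" "svars (Conjs \<phi>s) = (\<Union>\<phi>\<in>set \<phi>s. svars \<phi>)"
    unfolding Conjs_def by (induction \<phi>s) auto
qed (auto simp: Disj_def Ite_def Xor_def)

lemma schema_size_connectives [simp]:
  "schema_size (Disj a b) = schema_size a + schema_size b + 4"
  "schema_size (Ite c a b) = 2 * schema_size c + schema_size a + schema_size b + 7"
  "schema_size (Xor a b) = 2 * schema_size a + 2 * schema_size b + 8"
  "schema_size (Conjs \<phi>s) = 1 + (\<Sum>\<phi>\<leftarrow>\<phi>s. 1 + schema_size \<phi>)"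
proof -
  show "schema_size (Conjs \<phi>s) = 1 + (\<Sum>\<phi>\<leftarrow>\<phi>s. 1 + schema_size \<phi>)"
    unfolding Conjs_def by (induction \<phi>s) auto
qed (auto simp: Disj_def Ite_def Xor_def)


section \<open>Programs over arbitrary registers\<close>

definition reg_index :: "'r list \<Rightarrow> 'r \<Rightarrow> nat" where
  "reg_index rs r = (THE i. i < length rs \<and> rs ! i = r)"

lemma reg_index_nth: "distinct rs \<Longrightarrow> i < length rs \<Longrightarrow> reg_index rs (rs ! i) = i"
  unfolding reg_index_def by (rule the_equality) (auto simp: nth_eq_iff_index_eq)

text \<open>Head predicates must be naturals, so registers of any type are numbered by their
  positions in \<open>rs\<close>. Head predicates then coincide with head positions, and sets of
  circuit bits can serve as sets of predicates.\<close>

definition reg_program ::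
  "'r list \<Rightarrow> ('r \<Rightarrow> bool) \<Rightarrow> ('r \<Rightarrow> ('p, 'r) schema) \<Rightarrow> nat set \<Rightarrow> nat set \<Rightarrow> 'p program" where
  "reg_program rs ini step A P =
     \<lparr>heads = [0..<length rs],
      terminal = (\<lambda>i. if ini (rs ! i) then Top else Neg Top),
      iteration = (\<lambda>i. map_schema id (reg_index rs) (step (rs ! i))),
      attention_preds = A, print_preds = P\<rparr>"

primrec reg_val ::
  "('p, 'w) kripke \<Rightarrow> ('r \<Rightarrow> bool) \<Rightarrow> ('r \<Rightarrow> ('p, 'r) schema) \<Rightarrow> nat \<Rightarrow> 'w \<Rightarrow> 'r \<Rightarrow> bool" where
  "reg_val M ini step 0 w r = ini r"
| "reg_val M ini step (Suc t) w r = holds M (reg_val M ini step t) w (step r)"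

lemma msc_program_reg_program:
  assumes "distinct rs" and "\<And>r. r \<in> set rs \<Longrightarrow> step r \<in> schemata \<Pi> (set rs)"
    and "A \<subseteq> {..<length rs}" and "P \<subseteq> {..<length rs}"
  shows "msc_program \<Pi> (reg_program rs ini step A P)"
proof -
  have "map_schema id (reg_index rs) (step (rs ! i)) \<in> schemata \<Pi> {0..<length rs}"
    if "i < length rs" for i
  proof -
    have "step (rs ! i) \<in> schemata \<Pi> (set rs)"
      using assms(2) that by simp
    moreover have "reg_index rs ` set rs \<subseteq> {0..<length rs}"
      using assms(1) by (auto simp: in_set_conv_nth reg_index_nth)
    ultimately show ?thesis
      unfolding schemata_def by (auto simp: schema.set_map)
  qed
  then show ?thesis
    using assms(3,4)
    by (auto simp: msc_program_def reg_program_def modal_formulas_def schemata_def)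
qed

lemma sat_reg_program:
  assumes "distinct rs" and "\<And>r. r \<in> set rs \<Longrightarrow> svars (step r) \<subseteq> set rs" and "i < length rs"
  shows "sat M w (iteration_formula (reg_program rs ini step A P) t i) =
    reg_val M ini step t w (rs ! i)"
  using assms(3)
proof (induction t arbitrary: w i)
  case 0
  then show ?case by (simp add: reg_program_def)
next
  case (Suc t)
  let ?\<Gamma> = "reg_program rs ini step A P"
  \<comment> \<open>The numbering is faithful on \<open>rs\<close> only, hence the restriction to
    variables that occur in the clause.\<close>
  have "sat M v (iteration_formula ?\<Gamma> t (reg_index rs r)) = reg_val M ini step t v r"
    if "r \<in> svars (step (rs ! i))" for v r
  proof -
    have "r \<in> set rs" using assms(2) Suc.prems that by (meson nth_mem subsetD)
    then obtain j where "j < length rs" "r = rs ! j" by (metis in_set_conv_nth)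
    then show ?thesis using Suc.IH assms(1) by (simp add: reg_index_nth)
  qed
  then have "holds M (\<lambda>v r. sat M v (iteration_formula ?\<Gamma> t (reg_index rs r))) w (step (rs ! i)) =
      holds M (reg_val M ini step t) w (step (rs ! i))"
    by (rule holds_cong)
  then show ?case
    by (simp add: sat_schema_subst reg_program_def holds_map_schema)
qed

lemma configuration_reg_program:
  assumes "distinct rs" and "\<And>r. r \<in> set rs \<Longrightarrow> svars (step r) \<subseteq> set rs"
  shows "configuration (reg_program rs ini step A P) M w t = map (reg_val M ini step t w) rs"
  by (rule nth_equalityI)
    (auto simp: configuration_def sat_reg_program[OF assms] reg_program_def[of rs, THEN arg_cong[of _ _ heads]])

lemma head_positions_reg_program:
  "S \<subseteq> {..<length rs} \<Longrightarrow> head_positions (reg_program rs ini step A P) S = S"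
  by (auto simp: head_positions_def reg_program_def)

text \<open>The 4 accounts for the two head occurrences and a terminal clause of size at most 2,
  that of \<open>Neg Top\<close>.\<close>

lemma program_size_reg_program:
  fixes rs :: "'r list" and step :: "'r \<Rightarrow> ('p, 'r) schema"
  assumes "\<And>r. r \<in> set rs \<Longrightarrow> schema_size (step r) \<le> B"
  shows "program_size (reg_program rs ini step A P) \<le> length rs * (B + 4)"
proof -
  have "(\<Sum>i\<leftarrow>[0..<length rs]. 2 + schema_size (if ini (rs ! i) then Top else (Neg Top :: ('p, nat) schema)) +
      schema_size (step (rs ! i))) \<le> (\<Sum>i\<leftarrow>[0..<length rs]. 2 + 2 + B)"
    by (intro sum_list_mono add_mono) (use assms in \<open>auto intro: le_trans\<close>)
  then show ?thesis
    by (simp add: program_size_def reg_program_def schema_size_map_schema sum_list_triv add.commute)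
qed


section \<open>Acceptance of slowed down sequences\<close>

lemma accepts_in_unique: "accepts_in A b m \<Longrightarrow> accepts_in A b n \<Longrightarrow> m = n"
  unfolding accepts_in_def by (metis linorder_neqE_nat)

lemma output_of_eq: "accepts_in A b n \<Longrightarrow> output_of A P b = Some (nths (b n) P)"
  unfolding output_of_def using accepts_in_unique[of A b]
  by (metis (mono_tags, lifting) the_equality)

text \<open>On \<open>A\<close>, \<open>b\<close> is \<open>c\<close> slowed down by the factor
  \<open>T\<close> and delayed by one silent block. Round \<open>Suc n * T\<close> opens the block
  that shows \<open>c n\<close>, and every earlier round lies in an earlier block.\<close>

lemma accepts_in_slowed:
  assumes "T > 0" and "\<And>t i. i \<in> A \<Longrightarrow> b t ! i = (\<exists>n. t div T = Suc n \<and> c n ! i)"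
    and "accepts_in A c n"
  shows "accepts_in A b (Suc n * T)"
proof -
  have "b (Suc n * T) ! i = c n ! i" if "i \<in> A" for i
    using assms(1) assms(2)[OF that, of "Suc n * T"] by auto
  moreover have "\<not> b t ! i" if t: "t < Suc n * T" and i: "i \<in> A" for t i
  proof
    assume "b t ! i"
    then obtain m where m: "t div T = Suc m" "c m ! i" using assms(2) i by blast
    have "t div T < Suc n" using t assms(1) by (simp add: less_mult_imp_div_less)
    then have "m < n" using m(1) by simp
    then show False using m(2) assms(3) i unfolding accepts_in_def by blast
  qed
  ultimately show ?thesis
    using assms(3) unfolding accepts_in_def by blast
qed

text \<open>An attention bit set in \<open>b\<close> comes from one set in \<open>c\<close>, and the
  least round of \<open>c\<close> with such a bit accepts.\<close>

lemma accepts_in_slowedD: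
  assumes "\<And>t i. i \<in> A \<Longrightarrow> b t ! i = (\<exists>n. t div T = Suc n \<and> c n ! i)"
    and "accepts_in A b t"
  shows "\<exists>n. accepts_in A c n"
proof -
  have "\<exists>n. \<exists>i\<in>A. c n ! i"
    using assms unfolding accepts_in_def by blast
  then obtain n where "\<exists>i\<in>A. c n ! i" "\<And>m. m < n \<Longrightarrow> \<not> (\<exists>i\<in>A. c m ! i)"
    using exists_least_iff[of "\<lambda>n. \<exists>i\<in>A. c n ! i"] by blast
  then show ?thesis
    unfolding accepts_in_def by blast
qed


section \<open>Descending enumeration of bit strings\<close>

text \<open>Ripple carry: incrementing flips bit \<open>i\<close> exactly if the carry passes
  through all lower bits.\<close>

lemma bit_Suc_nat: "bit (Suc n) i = (bit n i \<noteq> (\<forall>j<i. bit n j))"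
proof (induction i arbitrary: n)
  case 0
  then show ?case by (simp add: bit_0)
next
  case (Suc i)
  show ?case
  proof (cases "even n")
    case True
    then have "Suc n div 2 = n div 2" by simp
    then show ?thesis using True by (auto simp: bit_Suc bit_0)
  next
    case False
    then have "Suc n div 2 = Suc (n div 2)" by simp
    then show ?thesis using False Suc.IH[of "n div 2"]
      by (auto simp: bit_Suc bit_0 All_less_Suc2)
  qed
qed

text \<open>Identifies the carry out of the last bit with the last value of the counter.\<close>

lemma all_bits_set_iff: "n < 2 ^ l \<Longrightarrow> (\<forall>j<l. bit n j) \<longleftrightarrow> n = 2 ^ l - (1::nat)"
proof (induction l arbitrary: n)
  case 0
  then show ?case by simp
next
  case (Suc l)
  have "(\<forall>j<Suc l. bit n j) \<longleftrightarrow> odd n \<and> (\<forall>j<l. bit (n div 2) j)"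
    by (simp only: All_less_Suc2 bit_Suc bit_0)
  also have "\<dots> \<longleftrightarrow> odd n \<and> n div 2 = 2 ^ l - 1"
    using Suc.IH[of "n div 2"] Suc.prems by simp
  also have "\<dots> \<longleftrightarrow> n = 2 * 2 ^ l - 1"
  proof -
    have "odd n \<and> n div 2 = p - 1 \<longleftrightarrow> n = 2 * p - 1" if "1 \<le> p" for p :: nat
      using that by presburger
    then show ?thesis by simp
  qed
  finally show ?case by simp
qed

text \<open>Enumerating the identifiers downwards lets a shift register end up with the smallest one first.\<close>

definition desc_bits :: "nat \<Rightarrow> nat \<Rightarrow> bool list" where
  "desc_bits l s = rev (map (\<lambda>i. \<not> bit s i) [0..<l])"

lemma length_desc_bits [simp]: "length (desc_bits l s) = l"
  by (simp add: desc_bits_def)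

lemma nth_desc_bits: "i < l \<Longrightarrow> desc_bits l s ! (l - 1 - i) = (\<not> bit s i)"
  by (simp add: desc_bits_def rev_nth)

lemma desc_bits_Suc: "desc_bits (Suc l) s = (\<not> bit s l) # desc_bits l s"
  by (simp add: desc_bits_def)

lemma desc_bits_mod: "desc_bits l (s mod 2 ^ l) = desc_bits l s"
  by (auto simp: desc_bits_def take_bit_eq_mod[symmetric] bit_take_bit_iff)

text \<open>The leading bit decides unless both numbers have it in common; complementing it reverses
  the order.\<close>

lemma desc_bits_strict_antimono:
  "s < s' \<Longrightarrow> s' < 2 ^ l \<Longrightarrow> desc_bits l s' < desc_bits l s"
proof (induction l arbitrary: s s')
  case 0
  then show ?case by simp
next
  case (Suc l)
  have bit: "bit r l \<longleftrightarrow> 2 ^ l \<le> r" if "r < 2 ^ Suc l" for r :: nat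
  proof -
    have "r div 2 ^ l < 2" using that by (simp add: less_mult_imp_div_less)
    then have "odd (r div 2 ^ l) \<longleftrightarrow> 1 \<le> r div 2 ^ l"
      by (cases "r div 2 ^ l" rule: nat.exhaust) (auto simp: less_Suc_eq)
    also have "\<dots> \<longleftrightarrow> 2 ^ l \<le> r" by (simp add: less_eq_div_iff_mult_less_eq)
    finally show ?thesis by (simp add: bit_iff_odd)
  qed
  have [simp]: "bit s l \<longleftrightarrow> 2 ^ l \<le> s" "bit s' l \<longleftrightarrow> 2 ^ l \<le> s'"
    using Suc.prems by (auto intro!: bit)
  consider "s' < 2 ^ l" | "s < 2 ^ l" "2 ^ l \<le> s'" | "2 ^ l \<le> s" "2 ^ l \<le> s'"
    using Suc.prems by linarith
  then show ?case
  proof cases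
    case 1
    then show ?thesis using Suc by (simp add: desc_bits_Suc)
  next
    case 2
    then show ?thesis by (simp add: desc_bits_Suc)
  next
    case 3
    \<comment> \<open>Both leading bits are set; subtracting \<open>2 ^ l\<close> removes them and
      leaves the lower \<open>l\<close> bits unchanged.\<close>
    have "desc_bits l (s' - 2 ^ l) < desc_bits l (s - 2 ^ l)"
      using Suc.prems 3 by (intro Suc.IH) auto
    moreover have "desc_bits l (r - 2 ^ l) = desc_bits l r" if "2 ^ l \<le> r" for r
      using that desc_bits_mod[of l "r - 2 ^ l"] desc_bits_mod[of l r] by (simp add: le_mod_geq)
    ultimately show ?thesis using 3 by (simp add: desc_bits_Suc)
  qed
qed

text \<open>Strict antitonicity gives injectivity, and the two sets have the same cardinality. Hence
  every possible identifier occurs in one pass of the counter.\<close>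

lemma desc_bits_image: "desc_bits l ` {..<2 ^ l} = {xs. length xs = l}"
proof (rule card_subset_eq)
  show "finite {xs :: bool list. length xs = l}"
    using finite_lists_length_eq[of "UNIV :: bool set" l] by simp
  have "inj_on (desc_bits l) {..<2 ^ l}"
    by (rule linorder_inj_onI) (use desc_bits_strict_antimono in fastforce)+
  then show "card (desc_bits l ` {..<2 ^ l}) = card {xs :: bool list. length xs = l}"
    using card_lists_length_eq[of "UNIV :: bool set" l] by (simp add: card_image)
qed auto


section \<open>Chains of wires\<close>

text \<open>Each step from \<open>c\<close> to \<open>b\<close> strictly enlarges the set of
  ancestors: \<open>c\<close> becomes one, but by acyclicity is not its own ancestor.\<close>

lemma relpow_card_ancestors:
  assumes "finite R" and "acyclic R" and "(a, b) \<in> R ^^ n"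
  shows "n + card {x. (x, a) \<in> R\<^sup>+} \<le> card {x. (x, b) \<in> R\<^sup>+}"
  using assms(3)
proof (induction n arbitrary: b)
  case 0
  then show ?case by simp
next
  case (Suc n)
  then obtain c where c: "(a, c) \<in> R ^^ n" "(c, b) \<in> R" by auto
  have "finite {x. (x, b) \<in> R\<^sup>+}"
    by (rule finite_subset[of _ "fst ` R\<^sup>+"]) (use assms(1) in \<open>force simp: finite_trancl\<close>)+
  moreover have "{x. (x, c) \<in> R\<^sup>+} \<subset> {x. (x, b) \<in> R\<^sup>+}"
    using c(2) assms(2) by (auto simp: acyclic_def intro: trancl_into_trancl)
  ultimately have "card {x. (x, c) \<in> R\<^sup>+} < card {x. (x, b) \<in> R\<^sup>+}"
    by (rule psubset_card_mono)
  then show ?case using Suc.IH[OF c(1)] by simp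
qed

context
  fixes C :: "'g circuit"
  assumes C: "boolean_circuit C"
begin

lemma finite_gates: "finite (gates C)" and wires_subset: "wires C \<subseteq> gates C \<times> gates C"
  and acyclic_wires: "acyclic (wires C)"
  using C by (auto simp: boolean_circuit_def)

lemma finite_wires: "finite (wires C)"
  using finite_gates wires_subset by (meson finite_SigmaI finite_subset)

lemma relpow_wires_less_card:
  assumes "g \<in> gates C" and "(h, g) \<in> wires C ^^ n"
  shows "n < card (gates C)"
proof -
  have "{x. (x, g) \<in> (wires C)\<^sup>+} \<subset> gates C"
    using trancl_subset_Sigma[OF wires_subset] acyclic_wires assms(1) by (auto simp: acyclic_def)
  then have "card {x. (x, g) \<in> (wires C)\<^sup>+} < card (gates C)"
    using finite_gates by (rule psubset_card_mono[rotated])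
  then show ?thesis
    using relpow_card_ancestors[OF finite_wires acyclic_wires assms(2)] by simp
qed

text \<open>\<open>card\<close> is 0 on infinite sets as well, so the finiteness of the circuit
  enters here.\<close>

lemma fan_in_eq_0_iff: "fan_in C g = 0 \<longleftrightarrow> (\<forall>h. (h, g) \<notin> wires C)"
proof -
  have "finite {h. (h, g) \<in> wires C}"
    using finite_gates wires_subset by (rule_tac finite_subset[of _ "gates C"]) auto
  then show ?thesis by (auto simp: fan_in_def)
qed

lemma fan_out_eq_0_iff: "fan_out C g = 0 \<longleftrightarrow> (\<forall>h. (g, h) \<notin> wires C)"
proof -
  have "finite {h. (g, h) \<in> wires C}"
    using finite_gates wires_subset by (rule_tac finite_subset[of _ "gates C"]) auto
  then show ?thesis by (auto simp: fan_out_def)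
qed

lemma set_inputs: "set (inputs C) = {g \<in> gates C. \<forall>h. (h, g) \<notin> wires C}"
  and set_outputs: "set (outputs C) = {g \<in> gates C. \<forall>h. (g, h) \<notin> wires C}"
  using C by (simp_all only: boolean_circuit_def fan_in_eq_0_iff fan_out_eq_0_iff)

lemma chain_from_input:
  assumes "g \<in> gates C"
  shows "\<exists>i\<in>set (inputs C). (i, g) \<in> (wires C)\<^sup>*"
proof -
  have "wf (wires C)" using finite_wires acyclic_wires by (rule finite_acyclic_wf)
  then show ?thesis using assms
  proof (induction g)
    case (less g)
    show ?case
    proof (cases "\<exists>h. (h, g) \<in> wires C")
      case True
      then obtain h where h: "(h, g) \<in> wires C" by blast
      then have "h \<in> gates C" using wires_subset by blast
      then obtain i where "i \<in> set (inputs C)" "(i, h) \<in> (wires C)\<^sup>*"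
        using less.IH[OF h] by blast
      then show ?thesis using h by (meson rtrancl.rtrancl_into_rtrancl)
    next
      case False
      then show ?thesis using less.prems by (auto simp: set_inputs)
    qed
  qed
qed

lemma chain_to_output:
  assumes "g \<in> gates C"
  shows "\<exists>i\<in>set (outputs C). (g, i) \<in> (wires C)\<^sup>*"
proof -
  have "wf ((wires C)\<inverse>)" using finite_wires acyclic_wires by (rule finite_acyclic_wf_converse)
  then show ?thesis using assms
  proof (induction g)
    case (less g)
    show ?case
    proof (cases "\<exists>h. (g, h) \<in> wires C")
      case True
      then obtain h where h: "(g, h) \<in> wires C" by blast
      then have "h \<in> gates C" using wires_subset by blast
      then obtain i where "i \<in> set (outputs C)" "(h, i) \<in> (wires C)\<^sup>*"
        using less.IH[of h] h by blast
      then show ?thesis using h by (meson converse_rtrancl_into_rtrancl)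
    next
      case False
      then show ?thesis using less.prems by (auto simp: set_outputs)
    qed
  qed
qed

definition chain_lengths :: "nat set" where
  "chain_lengths = {n. \<exists>g\<in>set (inputs C). \<exists>h\<in>set (outputs C). (g, h) \<in> wires C ^^ n}"

lemma chain_lengths_subset: "chain_lengths \<subseteq> {..<card (gates C)}"
proof
  fix n
  assume "n \<in> chain_lengths"
  then obtain g h where "h \<in> set (outputs C)" and chain: "(g, h) \<in> wires C ^^ n"
    unfolding chain_lengths_def by blast
  then have "h \<in> gates C" by (simp add: set_outputs)
  then show "n \<in> {..<card (gates C)}" using relpow_wires_less_card[OF _ chain] by simp
qed

lemma finite_chain_lengths: "finite chain_lengths"
  using chain_lengths_subset by (rule finite_subset) simp

text \<open>The depth counts only chains from inputs to outputs, but any chain between gates extends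
  backwards to an input and forwards to an output.\<close>

lemma relpow_wires_le_depth:
  assumes "g \<in> gates C" and "h \<in> gates C" and "(h, g) \<in> wires C ^^ n"
  shows "n \<le> circuit_depth C"
proof -
  obtain i where i: "i \<in> set (inputs C)" "(i, h) \<in> (wires C)\<^sup>*"
    using chain_from_input[OF assms(2)] by blast
  obtain j where j: "j \<in> set (outputs C)" "(g, j) \<in> (wires C)\<^sup>*"
    using chain_to_output[OF assms(1)] by blast
  obtain a where a: "(i, h) \<in> wires C ^^ a" using rtrancl_imp_relpow[OF i(2)] by blast
  obtain b where b: "(g, j) \<in> wires C ^^ b" using rtrancl_imp_relpow[OF j(2)] by blast
  have "(i, j) \<in> wires C ^^ (a + n + b)"
    using relpow_trans[OF relpow_trans[OF a assms(3)] b] .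
  then have "a + n + b \<in> chain_lengths"
    unfolding chain_lengths_def using i(1) j(1) by blast
  then have "a + n + b \<le> Sup chain_lengths"
    by (rule cSup_upper) (simp add: bdd_above_nat finite_chain_lengths)
  then show ?thesis by (simp add: circuit_depth_def chain_lengths_def)
qed

text \<open>The supremum is attained by an actual chain, which is shorter than the number of gates.
  This makes the number of \<open>Delay\<close> registers linear in the circuit size.\<close>

lemma circuit_depth_less_size:
  assumes "gates C \<noteq> {}"
  shows "circuit_depth C < circuit_size C"
proof -
  obtain g where "g \<in> gates C" using assms by blast
  then obtain i where i: "i \<in> set (inputs C)" using chain_from_input by blast
  then have "i \<in> gates C" by (simp add: set_inputs)
  then obtain j where j: "j \<in> set (outputs C)" "(i, j) \<in> (wires C)\<^sup>*"
    using chain_to_output by blast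
  obtain n where "(i, j) \<in> wires C ^^ n" using rtrancl_imp_relpow[OF j(2)] by blast
  then have "chain_lengths \<noteq> {}" unfolding chain_lengths_def using i j(1) by blast
  then have "Max chain_lengths \<in> chain_lengths" "Sup chain_lengths = Max chain_lengths"
    using finite_chain_lengths by (simp_all add: cSup_eq_Max)
  then have "Sup chain_lengths < card (gates C)"
    using chain_lengths_subset by auto
  then show ?thesis unfolding circuit_depth_def circuit_size_def chain_lengths_def .
qed

end

section \<open>The simulating program\<close>

text \<open>
  \<open>State\<close> holds the current circuit state, \<open>Slot\<close> is the shift register for the states of the
  neighbours, \<open>Bit\<close> and \<open>Carry\<close> form the counter (stage 0 is the least significant bit), \<open>Match i\<close>
  compares the last \<open>i\<close> identifier bits with the complemented counter, and \<open>Delay\<close> waits for the gates.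
\<close>

datatype 'g reg = State nat | Slot nat | Gate 'g | Bit nat | Carry nat | Match nat | Delay nat

locale translation =
  fixes Idn \<Pi> :: "'p::linorder set" and \<Delta> :: nat and C :: "'g mpc"
begin

abbreviation k :: nat where "k \<equiv> state_length C"

abbreviation l :: nat where "l \<equiv> card (\<Pi> \<inter> Idn)"

abbreviation d :: nat where "d \<equiv> circuit_depth (circ C)"

definition ids :: "'p list" where
  "ids = sorted_list_of_set (\<Pi> \<inter> Idn)"

definition gate_list :: "'g list" where
  "gate_list = (SOME gs. distinct gs \<and> set gs = gates (circ C))"

definition predecessors :: "'g \<Rightarrow> 'g list" where
  "predecessors g = filter (\<lambda>h. (h, g) \<in> wires (circ C)) gate_list"

text \<open>One schema per input gate, in the order in which the input string of the circuit is
  composed.\<close>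

definition sources :: "('p, 'g reg) schema list" where
  "sources = map Prop (sorted_list_of_set \<Pi>) @ map (\<lambda>j. SVar (State j)) [0..<k] @
     map (\<lambda>q. SVar (Slot q)) [0..<k * \<Delta>]"

text \<open>Since \<open>Delay (Suc d)\<close> marks the last round of a phase, the guard resets a
  register to false for the next phase.\<close>

definition unless_end :: "('p, 'g reg) schema \<Rightarrow> ('p, 'g reg) schema" where
  "unless_end \<phi> = Conj (Neg (SVar (Delay (Suc d)))) \<phi>"

text \<open>
  \<open>Delay 0\<close> is latched when the counter overflows, which stops later announcements; the latch
  reaches \<open>Delay (Suc d)\<close> in the last round of a phase.
\<close>

definition announced :: "('p, 'g reg) schema" where
  "announced = Conj (SVar (Match l)) (Neg (SVar (Delay 0)))"

text \<open>Gates are never reset: values left over from the previous phase are overwritten level by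
  level. The \<open>NotG\<close> case mirrors the existential clause of
  \<open>gate_value\<close>.\<close>

definition gate_step :: "'g \<Rightarrow> ('p, 'g reg) schema" where
  "gate_step g =
     (if predecessors g = [] then the (map_of (zip (inputs (circ C)) sources) g)
      else (case label (circ C) g of
          AndG \<Rightarrow> Conjs (map (\<lambda>h. SVar (Gate h)) (predecessors g))
        | OrG \<Rightarrow> Neg (Conjs (map (\<lambda>h. Neg (SVar (Gate h))) (predecessors g)))
        | NotG \<Rightarrow> Neg (Conjs (map (\<lambda>h. SVar (Gate h)) (predecessors g)))))"

text \<open>Updates are simultaneous, which yields the pipeline. \<open>Slot\<close> shifts by whole
  blocks of \<open>k\<close> bits. The index \<open>l - 1 - i\<close> occurs because identifiers
  start with the most significant bit and the counter with the least significant one.\<close>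

fun step :: "'g reg \<Rightarrow> ('p, 'g reg) schema" where
  "step (State j) = Ite (SVar (Delay (Suc d))) (SVar (Gate (outputs (circ C) ! j))) (SVar (State j))"
| "step (Slot q) = unless_end (Ite (Dia announced)
     (if q < k then Dia (Conj announced (SVar (State q))) else SVar (Slot (q - k))) (SVar (Slot q)))"
| "step (Gate g) = gate_step g"
| "step (Bit i) = unless_end (Xor (SVar (Bit i)) (SVar (Carry i)))"
| "step (Carry 0) = Top"
| "step (Carry (Suc i)) = unless_end (Conj (SVar (Carry i)) (SVar (Bit i)))"
| "step (Match 0) = Top"
| "step (Match (Suc i)) =
     unless_end (Conj (SVar (Match i)) (Xor (SVar (Bit i)) (Prop (ids ! (l - 1 - i)))))"
| "step (Delay 0) = unless_end (Disj (SVar (Delay 0)) (SVar (Carry l)))"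
| "step (Delay (Suc i)) = unless_end (SVar (Delay i))"

text \<open>Apart from the gates, this is what the end of a phase leaves in the control registers,
  with zero states; the first phase thus runs like any other.\<close>

definition initial :: "'g reg \<Rightarrow> bool" where
  "initial r \<longleftrightarrow> r = Carry 0 \<or> r = Match 0"

text \<open>The \<open>State\<close> registers come first, so attention and print bits keep their
  positions.\<close>

definition registers :: "'g reg list" where
  "registers = map State [0..<k] @ map Slot [0..<k * \<Delta>] @ map Gate gate_list @ map Bit [0..<l] @
     map Carry [0..<Suc l] @ map Match [0..<Suc l] @ map Delay [0..<d + 2]"

text \<open>\<open>l\<close> rounds fill the pipeline, \<open>2 ^ l\<close> rounds announce,
  \<open>d + 1\<close> rounds settle the gates and one round copies the new state.\<close>

definition phase :: nat where
  "phase = l + 2 ^ l + d + 2"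

text \<open>With \<open>k = 0\<close> there are no gates, so a linear size bound forces the empty
  program, while \<open>registers\<close> is never empty.\<close>

definition program :: "'p program" where
  "program = (if k = 0 then reg_program ([] :: 'g reg list) initial step {} {}
     else reg_program registers initial step (attention_bits C) (print_bits C))"

end

locale mpc_translation = translation +
  assumes finite_symbols: "finite \<Pi>" and mpc: "is_mpc \<Pi> \<Delta> C"
begin

section \<open>Well-formedness and linear size of the program\<close>

lemma circuit: "boolean_circuit (circ C)"
  and length_inputs: "length (inputs (circ C)) = card \<Pi> + k * (\<Delta> + 1)"
  and attention_bits_subset: "attention_bits C \<subseteq> {..<k}"
  and print_bits_subset: "print_bits C \<subseteq> {..<k}"
  using mpc by (auto simp: is_mpc_def)

lemma distinct_gate_list: "distinct gate_list" and set_gate_list: "set gate_list = gates (circ C)"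
proof -
  have "\<exists>gs. distinct gs \<and> set gs = gates (circ C)"
    using finite_distinct_list[OF finite_gates[OF circuit]] by blast
  then have "distinct gate_list \<and> set gate_list = gates (circ C)"
    unfolding gate_list_def by (rule someI_ex)
  then show "distinct gate_list" "set gate_list = gates (circ C)" by auto
qed

lemma length_gate_list: "length gate_list = circuit_size (circ C)"
  using distinct_card[OF distinct_gate_list] by (simp add: set_gate_list circuit_size_def)

lemma set_predecessors: "set (predecessors g) = {h. (h, g) \<in> wires (circ C)}"
  using wires_subset[OF circuit] by (auto simp: predecessors_def set_gate_list)

lemma length_predecessors: "length (predecessors g) = fan_in (circ C) g"
proof -
  have "distinct (predecessors g)" by (simp add: predecessors_def distinct_gate_list)
  then show ?thesis by (simp add: fan_in_def set_predecessors[symmetric] distinct_card)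
qed

lemma length_sources: "length sources = length (inputs (circ C))"
  using finite_symbols by (simp add: sources_def length_inputs)

lemma input_gate:
  assumes "g \<in> gates (circ C)" and "predecessors g = []"
  shows "g \<in> set (inputs (circ C))"
  using assms set_predecessors[of g] by (auto simp: set_inputs[OF circuit])

lemma zip_sources:
  assumes "g \<in> set (inputs (circ C))"
  shows "the (map_of (zip (inputs (circ C)) sources) g) \<in> set sources"
proof -
  obtain \<phi> where "map_of (zip (inputs (circ C)) sources) g = Some \<phi>"
    using assms length_sources by (metis map_of_zip_is_Some)
  then show ?thesis by (auto dest!: map_of_SomeD set_zip_rightD)
qed

lemma outputs_in_gates: "j < k \<Longrightarrow> outputs (circ C) ! j \<in> gates (circ C)"
  using set_outputs[OF circuit] nth_mem by (fastforce simp: state_length_def)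

lemma length_ids: "length ids = l" and set_ids: "set ids = \<Pi> \<inter> Idn"
  using finite_symbols by (simp_all add: ids_def)

lemma gate_step_in_schemata:
  assumes "g \<in> gates (circ C)"
  shows "gate_step g \<in> schemata \<Pi> (set registers)"
proof (cases "predecessors g = []")
  case True
  have "set sources \<subseteq> schemata \<Pi> (set registers)"
    using finite_symbols by (auto simp: sources_def schemata_def registers_def)
  then show ?thesis
    using zip_sources[OF input_gate[OF assms True]] True by (auto simp: gate_step_def)
next
  case False
  have "Gate h \<in> set registers" if "h \<in> set (predecessors g)" for h
    using that by (auto simp: registers_def predecessors_def)
  then show ?thesis
    using False by (auto simp: gate_step_def schemata_def split: gate_label.split)
qed

lemma step_in_schemata:
  assumes "r \<in> set registers"
  shows "step r \<in> schemata \<Pi> (set registers)"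
proof -
  have mem [simp]:
    "State j \<in> set registers \<longleftrightarrow> j < k" "Slot j \<in> set registers \<longleftrightarrow> j < k * \<Delta>"
    "Gate g \<in> set registers \<longleftrightarrow> g \<in> gates (circ C)" "Bit j \<in> set registers \<longleftrightarrow> j < l"
    "Carry j \<in> set registers \<longleftrightarrow> j \<le> l" "Match j \<in> set registers \<longleftrightarrow> j \<le> l"
    "Delay j \<in> set registers \<longleftrightarrow> j \<le> Suc d" for j g
    by (auto simp: registers_def set_gate_list)
  show ?thesis
  proof (cases r)
    case (Gate g)
    then show ?thesis using assms gate_step_in_schemata by simp
  next
    case (State j)
    then show ?thesis using assms by (auto simp: schemata_def outputs_in_gates)
  next
    case (Slot q)
    then show ?thesis using assms by (auto simp: schemata_def unless_end_def announced_def)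
  next
    case (Bit i)
    then show ?thesis using assms by (auto simp: schemata_def unless_end_def)
  next
    case (Carry i)
    then show ?thesis using assms by (cases i) (auto simp: schemata_def unless_end_def)
  next
    case (Match i)
    have "ids ! (l - 1 - i') \<in> \<Pi>" if "i = Suc i'" for i'
    proof -
      have "l - 1 - i' < length ids" using that assms Match by (simp add: length_ids)
      then show ?thesis using nth_mem set_ids by blast
    qed
    then show ?thesis using assms Match by (cases i) (auto simp: schemata_def unless_end_def)
  next
    case (Delay i)
    then show ?thesis using assms by (cases i) (auto simp: schemata_def unless_end_def)
  qed
qed

lemma distinct_registers: "distinct registers"
  by (auto simp: registers_def distinct_map inj_on_def distinct_gate_list)

lemma length_registers: "k \<le> length registers"
  by (simp add: registers_def)

lemma msc_program_program: "msc_program \<Pi> program"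
  unfolding program_def
  using attention_bits_subset print_bits_subset length_registers
  by (auto intro!: msc_program_reg_program distinct_registers step_in_schemata)

text \<open>Disjunction gates are the costliest: each predecessor contributes a conjunction, a
  negation and a variable, hence the factor 3.\<close>

lemma schema_size_step:
  assumes "fan_in_bounded c (circ C)" and "r \<in> set registers"
  shows "schema_size (step r) \<le> 3 * c + 50"
proof (cases r)
  case (Gate g)
  then have g: "g \<in> gates (circ C)" using assms(2) by (auto simp: registers_def set_gate_list)
  then have c: "length (predecessors g) \<le> c"
    using assms(1) by (simp add: length_predecessors fan_in_bounded_def)
  have "schema_size \<phi> = 1" if "\<phi> \<in> set sources" for \<phi>
    using that by (auto simp: sources_def)
  then show ?thesis
    using Gate c zip_sources[OF input_gate[OF g]]
    by (auto simp: gate_step_def comp_def sum_list_triv split: gate_label.split)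
next
  case (Carry i)
  then show ?thesis by (cases i) (auto simp: unless_end_def)
next
  case (Match i)
  then show ?thesis by (cases i) (auto simp: unless_end_def)
next
  case (Delay i)
  then show ?thesis by (cases i) (auto simp: unless_end_def)
qed (auto simp: unless_end_def announced_def)

text \<open>Each input bit has its own gate, so the circuit size also bounds the registers that
  depend on \<open>\<Pi>\<close> and \<open>\<Delta>\<close>.\<close>

lemma card_symbols_le_size: "card \<Pi> + k * (\<Delta> + 1) \<le> circuit_size (circ C)"
proof -
  have "length (inputs (circ C)) = card (set (inputs (circ C)))"
    by (rule distinct_card[symmetric]) (use circuit in \<open>simp add: boolean_circuit_def\<close>)
  also have "\<dots> \<le> card (gates (circ C))"
    by (rule card_mono) (auto simp: finite_gates[OF circuit] set_inputs[OF circuit])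
  finally show ?thesis by (simp add: length_inputs circuit_size_def)
qed

lemma program_size_program:
  assumes "fan_in_bounded c (circ C)"
  shows "program_size program \<le> 8 * (3 * c + 54) * circuit_size (circ C)"
proof (cases "k = 0")
  case True
  then show ?thesis by (simp add: program_def program_size_def reg_program_def)
next
  case False
  let ?N = "circuit_size (circ C)"
  have "0 < ?N" using False card_symbols_le_size by (simp add: le_eq_less_or_eq) linarith
  then have "gates (circ C) \<noteq> {}" by (auto simp: circuit_size_def)
  then have "d < ?N" by (rule circuit_depth_less_size[OF circuit])
  moreover have "l \<le> card \<Pi>" using finite_symbols by (simp add: card_mono)
  moreover have "k * (\<Delta> + 1) = k + k * \<Delta>" by simp
  \<comment> \<open>\<open>k * (\<Delta> + 1) + l\<close>, the gates, \<open>2 * l\<close> and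
    \<open>d + 4\<close> contribute at most 1, 1, 2 and 4 times \<open>?N\<close>; the constant 4 is
    absorbed because \<open>0 < ?N\<close>.\<close>
  ultimately have "length registers \<le> 8 * ?N"
    using card_symbols_le_size by (simp add: registers_def length_gate_list)
  then have "length registers * (3 * c + 54) \<le> 8 * ?N * (3 * c + 54)" by (rule mult_le_mono1)
  moreover have "program_size program \<le> length registers * (3 * c + 50 + 4)"
    using program_size_reg_program[of registers step "3 * c + 50", OF schema_size_step[OF assms]] False
    by (simp add: program_def)
  ultimately show ?thesis by (simp add: algebra_simps)
qed

end

section \<open>Correctness of the simulation\<close>

locale mpc_simulation = mpc_translation Idn \<Pi> \<Delta> C
  for Idn \<Pi> :: "'p::linorder set" and \<Delta> :: nat and C :: "'g mpc" +
  fixes M :: "('p, 'w) kripke"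
  assumes model: "M \<in> model_class Idn \<Pi> \<Delta>"
begin

abbreviation V :: "nat \<Rightarrow> 'w \<Rightarrow> 'g reg \<Rightarrow> bool" where
  "V \<equiv> reg_val M initial step"

abbreviation idn :: "'w \<Rightarrow> bool list" where
  "idn \<equiv> ID Idn \<Pi> M"

lemma succ_subset: "succ M w \<subseteq> worlds M"
  using model by (auto simp: model_class_def kripke_model_def succ_def)

lemma finite_succ: "finite (succ M w)"
  using finite_subset[OF succ_subset] model by (simp add: model_class_def)

lemma inj_on_idn: "inj_on idn (succ M w)"
  using model inj_on_subset[OF _ succ_subset] by (auto simp: model_class_def has_identifiers_def)

lemma card_succ: "w \<in> worlds M \<Longrightarrow> card (succ M w) \<le> \<Delta>"
  using model by (simp add: model_class_def)

lemma length_idn: "length (idn w) = l"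
  using length_ids by (simp add: ID_def bits_at_def ids_def)

lemma nth_idn: "j < l \<Longrightarrow> idn w ! j \<longleftrightarrow> w \<in> val M (ids ! j)"
  using length_ids by (simp add: ID_def bits_at_def ids_def)

lemma length_neighbours: "length (neighbours Idn \<Pi> M w) = card (succ M w)"
  by (simp add: neighbours_def card_image[OF inj_on_idn])

text \<open>Invariant of the first round of a phase, with \<open>x\<close> the vector of circuit
  states. It leaves the \<open>Gate\<close> registers unconstrained.\<close>

definition phase_start :: "nat \<Rightarrow> ('w \<Rightarrow> bool list) \<Rightarrow> bool" where
  "phase_start t x \<longleftrightarrow> (\<forall>w\<in>worlds M. length (x w) = k \<and>
     (\<forall>j<k. V t w (State j) = x w ! j) \<and> (\<forall>q<k * \<Delta>. \<not> V t w (Slot q)) \<and>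
     (\<forall>i<l. \<not> V t w (Bit i)) \<and> (\<forall>i\<le>l. V t w (Carry i) = (i = 0)) \<and>
     (\<forall>i\<le>l. V t w (Match i) = (i = 0)) \<and> (\<forall>i\<le>Suc d. \<not> V t w (Delay i)))"

text \<open>
  Stage \<open>i\<close> of the counter lags \<open>i\<close> rounds behind stage 0: after \<open>\<tau>\<close> rounds its bit is bit \<open>i\<close>
  of the number \<open>\<tau> - i\<close>, where truncated subtraction gives the correct initial value 0.
\<close>

lemma control:
  assumes start: "phase_start t x" and w: "w \<in> worlds M" and "\<tau> < phase"
  shows "(\<forall>i\<le>Suc d. V (t + \<tau>) w (Delay i) \<longleftrightarrow> l + 2 ^ l + i \<le> \<tau>) \<and>
    (\<forall>i<l. V (t + \<tau>) w (Bit i) \<longleftrightarrow> bit (\<tau> - i) i) \<and>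
    (\<forall>i\<le>l. V (t + \<tau>) w (Carry i) \<longleftrightarrow> (\<forall>j<i. bit (\<tau> - i) j)) \<and>
    (\<forall>i\<le>l. V (t + \<tau>) w (Match i) \<longleftrightarrow>
       i \<le> \<tau> \<and> (\<forall>j<i. bit (\<tau> - i) j \<noteq> (w \<in> val M (ids ! (l - 1 - j))))) \<and>
    (\<forall>j<k. V (t + \<tau>) w (State j) \<longleftrightarrow> x w ! j)"
  using assms(3)
proof (induction \<tau>)
  case 0
  then show ?case using start w by (auto simp: phase_start_def)
next
  case (Suc \<tau>)
  then have "\<tau> < phase" by simp
  note IH = Suc.IH[OF this]
  \<comment> \<open>Round \<open>\<tau>\<close> is not the last one of the phase, so no reset takes
    effect in the step to \<open>Suc \<tau>\<close>.\<close>
  have no_end: "\<not> V (t + \<tau>) w (Delay (Suc d))"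
    using IH Suc.prems by (simp add: phase_def)
  have "V (t + Suc \<tau>) w (Delay i) \<longleftrightarrow> l + 2 ^ l + i \<le> Suc \<tau>" if "i \<le> Suc d" for i
  proof (cases i)
    case 0
    \<comment> \<open>While the pipeline fills, truncated subtraction gives 0;
      \<open>l < 2 ^ l\<close> prevents this 0 from being taken for the last value.\<close>
    have "(\<forall>j<l. bit (\<tau> - l) j) \<longleftrightarrow> l + 2 ^ l = Suc \<tau>" if "\<tau> < l + 2 ^ l"
    proof -
      have "\<tau> - l < 2 ^ l" using that by (cases "l \<le> \<tau>") (auto simp: less_diff_conv2)
      moreover have "\<tau> - a = p - 1 \<longleftrightarrow> a + p = Suc \<tau>" if "\<tau> < a + p" "a < p" for a p
        using that by arith
      ultimately show ?thesis
        using that by (simp add: all_bits_set_iff)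
    qed
    then show ?thesis using IH no_end 0 by (auto simp: unless_end_def)
  next
    case (Suc i')
    then show ?thesis using IH no_end that by (simp add: unless_end_def)
  qed
  moreover have "V (t + Suc \<tau>) w (Bit i) \<longleftrightarrow> bit (Suc \<tau> - i) i" if "i < l" for i
  proof -
    have "V (t + Suc \<tau>) w (Bit i) \<longleftrightarrow> bit (\<tau> - i) i \<noteq> (\<forall>j<i. bit (\<tau> - i) j)"
      using IH no_end that by (simp add: unless_end_def)
    \<comment> \<open>If \<open>\<tau> < i\<close>, both numbers are 0 and no carry may arrive;
      \<open>\<tau>\<close> itself is the position of a lower unset bit.\<close>
    also have "\<dots> \<longleftrightarrow> bit (Suc \<tau> - i) i"
      by (cases "i \<le> \<tau>") (auto simp: Suc_diff_le bit_Suc_nat intro!: exI[of _ \<tau>])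
    finally show ?thesis .
  qed
  moreover have "V (t + Suc \<tau>) w (Carry i) \<longleftrightarrow> (\<forall>j<i. bit (Suc \<tau> - i) j)" if "i \<le> l" for i
    using IH no_end that by (cases i) (auto simp: unless_end_def less_Suc_eq)
  \<comment> \<open>Stages not yet reached by the pipeline are still false although the number 0
    might match; the conjunct on \<open>i\<close> records this.\<close>
  moreover have "V (t + Suc \<tau>) w (Match i) \<longleftrightarrow>
      i \<le> Suc \<tau> \<and> (\<forall>j<i. bit (Suc \<tau> - i) j \<noteq> (w \<in> val M (ids ! (l - 1 - j))))" if "i \<le> l" for i
    using IH no_end that by (cases i) (auto simp: unless_end_def less_Suc_eq)
  moreover have "V (t + Suc \<tau>) w (State j) \<longleftrightarrow> x w ! j" if "j < k" for j
    using IH no_end that by simp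
  ultimately show ?case by blast
qed

text \<open>The low \<open>l\<close> bits of the counter start over after \<open>2 ^ l\<close>
  values; the latch \<open>Delay 0\<close> keeps a node from announcing itself again.\<close>

lemma announced_iff:
  assumes "phase_start t x" and "w \<in> worlds M" and "\<tau> < phase"
  shows "holds M (V (t + \<tau>)) w announced \<longleftrightarrow>
    l \<le> \<tau> \<and> \<tau> < l + 2 ^ l \<and> idn w = desc_bits l (\<tau> - l)"
proof -
  have "idn w = desc_bits l s \<longleftrightarrow> (\<forall>j<l. bit s j \<noteq> (w \<in> val M (ids ! (l - 1 - j))))" for s
  proof
    assume eq: "idn w = desc_bits l s"
    show "\<forall>j<l. bit s j \<noteq> (w \<in> val M (ids ! (l - 1 - j)))"
    proof (intro allI impI)
      fix j
      assume "j < l"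
      then show "bit s j \<noteq> (w \<in> val M (ids ! (l - 1 - j)))"
        using nth_idn[of "l - 1 - j" w] nth_desc_bits[of j l s] eq by auto
    qed
  next
    assume neq: "\<forall>j<l. bit s j \<noteq> (w \<in> val M (ids ! (l - 1 - j)))"
    show "idn w = desc_bits l s"
    proof (rule nth_equalityI)
      fix i
      assume "i < length (idn w)"
      then have i: "i < l" by (simp add: length_idn)
      define j where "j = l - 1 - i"
      have j: "j < l" "i = l - 1 - j" using i by (auto simp: j_def)
      have "bit s j \<noteq> (w \<in> val M (ids ! i))" using neq j by simp
      moreover have "desc_bits l s ! i \<longleftrightarrow> \<not> bit s j" using nth_desc_bits[OF j(1), of s] j(2) by simp
      ultimately show "idn w ! i = desc_bits l s ! i" using nth_idn[OF i] by blast
    qed (simp add: length_idn)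
  qed
  then show ?thesis
    using control[OF assms] by (auto simp: announced_def not_le)
qed

section \<open>Arrival of the successors' states in the shift register\<close>

definition inbox :: "('w \<Rightarrow> bool list) \<Rightarrow> 'w \<Rightarrow> nat \<Rightarrow> bool list" where
  "inbox x w s = concat (map (\<lambda>a. x (inv_into (succ M w) idn a))
     (sorted_list_of_set (idn ` succ M w \<inter> desc_bits l ` {..<s})))"

lemma inbox_0: "inbox x w 0 = []"
  by (simp add: inbox_def)

lemma inbox_full: "inbox x w (2 ^ l) = concat (map x (neighbours Idn \<Pi> M w))"
proof -
  have "idn ` succ M w \<inter> desc_bits l ` {..<2 ^ l} = idn ` succ M w"
    by (auto simp: desc_bits_image length_idn)
  then show ?thesis by (simp add: inbox_def neighbours_def comp_def)
qed

lemma inbox_Suc_absent: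
  assumes "desc_bits l s \<notin> idn ` succ M w"
  shows "inbox x w (Suc s) = inbox x w s"
  using assms by (simp add: inbox_def lessThan_Suc)

text \<open>Identifiers appear in descending order, so the new one precedes all earlier ones and its
  state goes to the front.\<close>

lemma inbox_Suc:
  assumes "s < 2 ^ l" and "v \<in> succ M w" and "idn v = desc_bits l s"
  shows "inbox x w (Suc s) = x v @ inbox x w s"
proof -
  let ?D = "idn ` succ M w \<inter> desc_bits l ` {..<s}"
  have less: "desc_bits l s < a" if "a \<in> ?D" for a
    using that desc_bits_strict_antimono assms(1) by auto
  have fin: "finite ?D" by (simp add: finite_succ)
  have "idn ` succ M w \<inter> desc_bits l ` {..<Suc s} = insert (desc_bits l s) ?D"
    using assms(2,3) by (auto simp: lessThan_Suc intro: image_eqI[of _ _ v])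
  moreover have "sorted_list_of_set (insert (desc_bits l s) ?D) =
      insort (desc_bits l s) (sorted_list_of_set ?D)"
    using fin less by (intro sorted_list_of_set_insert) auto
  moreover have "\<dots> = desc_bits l s # sorted_list_of_set ?D"
    using fin less by (intro insort_is_Cons) (auto intro: less_imp_le)
  moreover have "inv_into (succ M w) idn (desc_bits l s) = v"
    using inv_into_f_f[OF inj_on_idn assms(2)] assms(3) by simp
  ultimately show ?thesis by (simp add: inbox_def)
qed

text \<open>The number \<open>min (\<tau> - l) (2 ^ l)\<close> counts the values already processed:
  value \<open>\<tau> - l\<close> is announced in round \<open>\<tau>\<close> and visible in the
  slots one round later.\<close>

lemma slots:
  assumes start: "phase_start t x" and w: "w \<in> worlds M" and "\<tau> < phase" and "q < k * \<Delta>"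
  shows "V (t + \<tau>) w (Slot q) \<longleftrightarrow>
    q < length (inbox x w (min (\<tau> - l) (2 ^ l))) \<and> inbox x w (min (\<tau> - l) (2 ^ l)) ! q"
  using assms(3,4)
proof (induction \<tau> arbitrary: q)
  case 0
  then show ?case using start w by (auto simp: phase_start_def inbox_0)
next
  case (Suc \<tau>)
  then have \<tau>: "\<tau> < phase" by simp
  note IH = Suc.IH[OF this]
  have no_end: "\<not> V (t + \<tau>) w (Delay (Suc d))"
    using control[OF start w \<tau>] Suc.prems by (simp add: phase_def)
  have ann: "holds M (V (t + \<tau>)) v announced \<longleftrightarrow>
      l \<le> \<tau> \<and> \<tau> < l + 2 ^ l \<and> idn v = desc_bits l (\<tau> - l)" if "v \<in> succ M w" for v
    using announced_iff[OF start _ \<tau>] that succ_subset by blast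
  show ?case
  proof (cases "l \<le> \<tau> \<and> \<tau> < l + 2 ^ l \<and> desc_bits l (\<tau> - l) \<in> idn ` succ M w")
    case True
    define s where "s = \<tau> - l"
    have s: "min (\<tau> - l) (2 ^ l) = s" "min (Suc \<tau> - l) (2 ^ l) = Suc s" "s < 2 ^ l"
      using True by (auto simp: s_def)
    obtain v where v: "v \<in> succ M w" "idn v = desc_bits l s" using True by (auto simp: s_def)
    \<comment> \<open>Identifiers are injective, so a single successor announces itself and the
      diamond reads exactly its state.\<close>
    have uniq: "holds M (V (t + \<tau>)) u announced \<longleftrightarrow> u = v" if "u \<in> succ M w" for u
      using ann[OF that] True v that inj_onD[OF inj_on_idn, of u v w] unfolding s_def by auto
    have vw: "v \<in> worlds M" using v(1) succ_subset by blast
    have xv: "length (x v) = k" using start vw by (simp add: phase_start_def)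
    have "V (t + Suc \<tau>) w (Slot q) \<longleftrightarrow>
        (if q < k then V (t + \<tau>) v (State q) else V (t + \<tau>) w (Slot (q - k)))"
      using uniq v(1) no_end by (auto simp: unless_end_def)
    also have "\<dots> \<longleftrightarrow> q < length (x v @ inbox x w s) \<and> (x v @ inbox x w s) ! q"
      using control[OF start vw \<tau>] IH[of "q - k"] Suc.prems(2) xv by (auto simp: s nth_append)
    finally show ?thesis unfolding s inbox_Suc[OF s(3) v] .
  next
    case False
    have "inbox x w (min (Suc \<tau> - l) (2 ^ l)) = inbox x w (min (\<tau> - l) (2 ^ l))"
    proof (cases "l \<le> \<tau> \<and> \<tau> < l + 2 ^ l")
      case True
      then have "min (\<tau> - l) (2 ^ l) = \<tau> - l" "min (Suc \<tau> - l) (2 ^ l) = Suc (\<tau> - l)" by auto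
      then show ?thesis using False True inbox_Suc_absent by simp
    next
      case False
      then have "min (Suc \<tau> - l) (2 ^ l) = min (\<tau> - l) (2 ^ l)" by linarith
      then show ?thesis by simp
    qed
    moreover have "\<not> holds M (V (t + \<tau>)) v announced" if "v \<in> succ M w" for v
      using ann[OF that] False that by (metis image_eqI)
    ultimately show ?thesis using no_end IH[OF Suc.prems(2)] by (auto simp: unless_end_def)
  qed
qed

section \<open>Settling of the gates and passage to the next phase\<close>

definition circuit_input :: "('w \<Rightarrow> bool list) \<Rightarrow> 'w \<Rightarrow> bool list" where
  "circuit_input x w = local_input \<Pi> M w @ x w @ concat (map x (neighbours Idn \<Pi> M w)) @
     replicate (k * (\<Delta> - length (neighbours Idn \<Pi> M w))) False"

lemma set_neighbours: "set (neighbours Idn \<Pi> M w) \<subseteq> worlds M"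
proof -
  have "set (neighbours Idn \<Pi> M w) \<subseteq> succ M w"
    by (auto simp: neighbours_def finite_succ inv_into_into)
  then show ?thesis using succ_subset by blast
qed

text \<open>Once all identifiers have been announced, the slots never reached are still false and
  supply the zero padding for missing neighbours.\<close>

lemma holds_sources:
  assumes start: "phase_start t x" and w: "w \<in> worlds M" and \<tau>: "\<tau> < phase" "l + 2 ^ l \<le> \<tau>"
  shows "map (holds M (V (t + \<tau>)) w) sources = circuit_input x w"
proof -
  let ?nbs = "neighbours Idn \<Pi> M w"
  let ?c = "concat (map x ?nbs)"
  have len: "length (x v) = k" if "v \<in> worlds M" for v
    using start that by (simp add: phase_start_def)
  have "length (concat (map x vs)) = k * length vs" if "set vs \<subseteq> worlds M" for vs
    using that by (induction vs) (auto simp: len)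
  then have lenc: "length ?c = k * length ?nbs" using set_neighbours by blast
  have le: "length ?nbs \<le> \<Delta>" using card_succ[OF w] by (simp add: length_neighbours)
  have "map (\<lambda>q. V (t + \<tau>) w (Slot q)) [0..<k * \<Delta>] = ?c @ replicate (k * (\<Delta> - length ?nbs)) False"
  proof (rule nth_equalityI)
    show "length (map (\<lambda>q. V (t + \<tau>) w (Slot q)) [0..<k * \<Delta>]) =
        length (?c @ replicate (k * (\<Delta> - length ?nbs)) False)"
      using le by (simp add: lenc diff_mult_distrib2 mult_le_mono)
  next
    fix q
    assume "q < length (map (\<lambda>q. V (t + \<tau>) w (Slot q)) [0..<k * \<Delta>])"
    then have q: "q < k * \<Delta>" by simp
    have "min (\<tau> - l) (2 ^ l) = 2 ^ l" using \<tau>(2) by simp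
    then show "map (\<lambda>q. V (t + \<tau>) w (Slot q)) [0..<k * \<Delta>] ! q =
        (?c @ replicate (k * (\<Delta> - length ?nbs)) False) ! q"
      using slots[OF start w \<tau>(1) q] q le
      by (auto simp: inbox_full nth_append lenc diff_mult_distrib2 simp del: reg_val.simps)
  qed
  moreover have "map (\<lambda>j. V (t + \<tau>) w (State j)) [0..<k] = x w"
    using control[OF start w \<tau>(1)] len[OF w] by (intro nth_equalityI) auto
  ultimately show ?thesis
    by (simp add: sources_def circuit_input_def local_input_def bits_at_def comp_def)
qed

text \<open>The condition on chains says that \<open>g\<close> has height at most \<open>m\<close>.
  Each level settles one round after the level below it; the first needs one round to read the
  stable sources, hence the strict inequality.\<close>

lemma gates_settle:
  assumes start: "phase_start t x" and w: "w \<in> worlds M" and "g \<in> gates (circ C)"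
    and "\<And>h. (h, g) \<notin> wires (circ C) ^^ Suc m"
    and "\<tau> < phase" and "l + 2 ^ l + m < \<tau>"
  shows "V (t + \<tau>) w (Gate g) \<longleftrightarrow> gate_value (circ C) (circuit_input x w) g"
  using assms(3-)
proof (induction m arbitrary: g \<tau> rule: less_induct)
  case (less m)
  obtain \<tau>' where \<tau>': "\<tau> = Suc \<tau>'" using less.prems(4) by (cases \<tau>) auto
  have \<tau>'_bounds: "\<tau>' < phase" "l + 2 ^ l + m \<le> \<tau>'" using less.prems(3,4) \<tau>' by auto
  show ?case
  proof (cases "predecessors g = []")
    case True
    let ?I = "inputs (circ C)"
    have "V (t + \<tau>) w (Gate g) = holds M (V (t + \<tau>')) w (the (map_of (zip ?I sources) g))"
      using True by (simp add: \<tau>' gate_step_def)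
    \<comment> \<open>\<open>the\<close> is known to commute with \<open>map_option\<close> only on
      a defined value, so \<open>g\<close> must be an input gate.\<close>
    also have "\<dots> = the (map_option (holds M (V (t + \<tau>')) w) (map_of (zip ?I sources) g))"
    proof -
      have "\<exists>a. map_of (zip ?I sources) g = Some a"
        using input_gate[OF less.prems(1) True] length_sources by (metis map_of_zip_is_Some)
      then show ?thesis by auto
    qed
    also have "\<dots> = the (map_of (zip ?I (map (holds M (V (t + \<tau>')) w) sources)) g)"
      by (simp add: zip_map2 map_of_map)
    also have "map (holds M (V (t + \<tau>')) w) sources = circuit_input x w"
      using \<tau>'_bounds by (intro holds_sources[OF start w]) auto
    finally show ?thesis
      using True set_predecessors[of g] by (simp add: gate_value_rec[OF circuit])
  next
    case False
    then obtain h0 where h0: "(h0, g) \<in> wires (circ C)"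
      using set_predecessors[of g] by (metis list.set_intros(1) mem_Collect_eq neq_Nil_conv)
    \<comment> \<open>The wire from \<open>h0\<close> is a chain of length 1.\<close>
    have "m \<noteq> 0" using less.prems(2)[of h0] h0 by auto
    then obtain m' where m': "m = Suc m'" by (cases m) auto
    have IH: "V (t + \<tau>') w (Gate h) \<longleftrightarrow> gate_value (circ C) (circuit_input x w) h"
      if "(h, g) \<in> wires (circ C)" for h
    proof (rule less.IH[of m'])
      show "h \<in> gates (circ C)" using that wires_subset[OF circuit] by blast
      show "(h', h) \<notin> wires (circ C) ^^ Suc m'" for h'
        using less.prems(2)[of h'] that unfolding m' by auto
    qed (use m' \<tau>'_bounds in auto)
    have "V (t + \<tau>) w (Gate g) = holds M (V (t + \<tau>')) w (gate_step g)"
      by (simp add: \<tau>')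
    also have "\<dots> = gate_value (circ C) (circuit_input x w) g"
      using False IH h0
      by (subst gate_value_rec[OF circuit])
        (auto simp: gate_step_def set_predecessors split: gate_label.split)
    finally show ?thesis .
  qed
qed

lemma phase_step:
  assumes start: "phase_start t x"
  shows "phase_start (t + phase) (\<lambda>w. circuit_fun (circ C) (circuit_input x w))"
  unfolding phase_start_def
proof (intro ballI)
  fix w
  assume w: "w \<in> worlds M"
  define \<tau> where "\<tau> = l + 2 ^ l + d + 1"
  have \<tau>: "\<tau> < phase" "l + 2 ^ l + d < \<tau>" and phase: "t + phase = Suc (t + \<tau>)"
    by (simp_all add: \<tau>_def phase_def)
  have the_end: "V (t + \<tau>) w (Delay (Suc d))"
    using control[OF start w \<tau>(1)] by (simp add: \<tau>_def del: reg_val.simps)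
  have "V (t + \<tau>) w (Gate g) \<longleftrightarrow> gate_value (circ C) (circuit_input x w) g"
    if g: "g \<in> gates (circ C)" for g
  proof (rule gates_settle[OF start w g _ \<tau>])
    \<comment> \<open>The depth bounds every chain between gates, so all gates have settled by the
      last round of the phase.\<close>
    show "(h, g) \<notin> wires (circ C) ^^ Suc d" for h
    proof
      assume chain: "(h, g) \<in> wires (circ C) ^^ Suc d"
      then obtain h' where "(h, h') \<in> wires (circ C)" by (meson relpow_Suc_D2)
      then have "h \<in> gates (circ C)" using wires_subset[OF circuit] by blast
      then show False using relpow_wires_le_depth[OF circuit g _ chain] by simp
    qed
  qed
  then have "V (t + phase) w (State j) \<longleftrightarrow> circuit_fun (circ C) (circuit_input x w) ! j" if "j < k" for j
    using that the_end outputs_in_gates unfolding phase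
    by (simp add: circuit_fun_def state_length_def)
  moreover have "V (t + phase) w (Carry i) \<longleftrightarrow> i = 0" "V (t + phase) w (Match i) \<longleftrightarrow> i = 0"
    "\<not> V (t + phase) w (Delay i)" for i
    unfolding phase using the_end by (cases i; simp add: unless_end_def)+
  moreover have "\<not> V (t + phase) w (Slot i)" "\<not> V (t + phase) w (Bit i)" for i
    unfolding phase using the_end by (simp_all add: unless_end_def)
  moreover have "length (circuit_fun (circ C) (circuit_input x w)) = k"
    by (simp add: circuit_fun_def state_length_def)
  ultimately show "length (circuit_fun (circ C) (circuit_input x w)) = k \<and>
     (\<forall>j<k. V (t + phase) w (State j) = circuit_fun (circ C) (circuit_input x w) ! j) \<and>
     (\<forall>q<k * \<Delta>. \<not> V (t + phase) w (Slot q)) \<and>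
     (\<forall>i<l. \<not> V (t + phase) w (Bit i)) \<and> (\<forall>i\<le>l. V (t + phase) w (Carry i) = (i = 0)) \<and>
     (\<forall>i\<le>l. V (t + phase) w (Match i) = (i = 0)) \<and> (\<forall>i\<le>Suc d. \<not> V (t + phase) w (Delay i))"
    by blast
qed

text \<open>The first phase starts from the zero state, so it takes one phase more to reach round \<open>n\<close>.\<close>

primrec carried :: "nat \<Rightarrow> 'w \<Rightarrow> bool list" where
  "carried 0 w = replicate k False"
| "carried (Suc n) w = mpc_state Idn \<Pi> \<Delta> C M n w"

text \<open>For \<open>n = 0\<close> the zero states of the node and its neighbours, together with
  the padding, form the zero block that the circuit reads in round 0.\<close>

lemma circuit_input_carried:
  assumes "w \<in> worlds M"
  shows "circuit_fun (circ C) (circuit_input (carried n) w) = carried (Suc n) w"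
proof (cases n)
  case 0
  let ?nbs = "neighbours Idn \<Pi> M w"
  have "concat (map (\<lambda>_. replicate k False) xs) = replicate (k * length xs) False" for xs :: "'w list"
    by (induction xs) (simp_all add: replicate_add)
  moreover have "carried 0 = (\<lambda>_. replicate k False)" by auto
  moreover have "length ?nbs \<le> \<Delta>" using card_succ[OF assms] by (simp add: length_neighbours)
  then have "k * (\<Delta> + 1) = k + (k * length ?nbs + k * (\<Delta> - length ?nbs))"
    by (simp add: add_mult_distrib2[symmetric])
  ultimately show ?thesis
    by (simp only: 0 circuit_input_def carried.simps mpc_state.simps replicate_add)
next
  case (Suc m)
  have "carried (Suc m) = mpc_state Idn \<Pi> \<Delta> C M m" by auto
  then show ?thesis by (simp add: Suc circuit_input_def)
qed

lemma phase_start_carried: "phase_start (n * phase) (carried n)"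
proof (induction n)
  case 0
  then show ?case by (simp add: phase_start_def initial_def)
next
  case (Suc n)
  have "phase_start (n * phase + phase) (\<lambda>w. circuit_fun (circ C) (circuit_input (carried n) w))"
    by (rule phase_step[OF Suc.IH])
  \<comment> \<open>\<open>phase_start\<close> inspects the state vector at worlds only, where the
    two vectors agree.\<close>
  then show ?case
    by (simp add: phase_start_def circuit_input_carried add.commute del: carried.simps)
qed

section \<open>From registers to acceptance, output and computation time\<close>

lemma State_carried:
  assumes "w \<in> worlds M" and "j < k"
  shows "V t w (State j) \<longleftrightarrow> carried (t div phase) w ! j"
proof -
  have "t mod phase < phase" by (simp add: phase_def)
  then have "V (t div phase * phase + t mod phase) w (State j) \<longleftrightarrow> carried (t div phase) w ! j"
    using control[OF phase_start_carried assms(1)] assms(2) by blast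
  then show ?thesis by simp
qed

text \<open>States are constant within a phase and zero in phase 0, so the program shows the states
  of the circuit slowed down and one phase late.\<close>

lemma configuration_nth:
  assumes "k \<noteq> 0" and "w \<in> worlds M" and "j < k"
  shows "configuration program M w t ! j \<longleftrightarrow>
    (\<exists>n. t div phase = Suc n \<and> mpc_state Idn \<Pi> \<Delta> C M n w ! j)"
proof -
  have "configuration program M w t = map (V t w) registers"
    using assms(1) step_in_schemata
    by (simp add: program_def configuration_reg_program distinct_registers schemata_def)
  then have "configuration program M w t ! j \<longleftrightarrow> V t w (State j)"
    using assms(3) by (simp add: registers_def nth_append)
  then show ?thesis
    using assms(3) by (cases "t div phase") (simp_all add: State_carried[OF assms(2,3)])
qed

lemma attention_positions: "head_positions program (attention_preds program) = attention_bits C"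
  and print_positions: "head_positions program (print_preds program) = print_bits C"
proof -
  have "attention_preds (reg_program rs ini st A P) = A" "print_preds (reg_program rs ini st A P) = P"
    for rs :: "'g reg list" and ini and st :: "'g reg \<Rightarrow> ('p, 'g reg) schema" and A P
    by (simp_all add: reg_program_def)
  moreover have "attention_bits C \<subseteq> {..<length registers}" "print_bits C \<subseteq> {..<length registers}"
    using attention_bits_subset print_bits_subset length_registers by auto
  ultimately show "head_positions program (attention_preds program) = attention_bits C"
    "head_positions program (print_preds program) = print_bits C"
    using attention_bits_subset print_bits_subset
    by (auto simp: program_def head_positions_reg_program)
qed

lemma accepts_program:
  assumes "w \<in> worlds M" and "mpc_accepts_in Idn \<Pi> \<Delta> C M w n"
  shows "program_accepts_in program M w (Suc n * phase)"
proof -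
  \<comment> \<open>Acceptance requires an attention bit, which is a position below
    \<open>k\<close>.\<close>
  have "k \<noteq> 0" using assms(2) attention_bits_subset by (auto simp: mpc_accepts_in_def accepts_in_def)
  have "accepts_in (attention_bits C) (configuration program M w) (Suc n * phase)"
  proof (rule accepts_in_slowed)
    show "0 < phase" by (simp add: phase_def)
    show "accepts_in (attention_bits C) (\<lambda>m. mpc_state Idn \<Pi> \<Delta> C M m w) n"
      using assms(2) by (simp add: mpc_accepts_in_def)
    show "configuration program M w t ! i =
        (\<exists>n. t div phase = Suc n \<and> mpc_state Idn \<Pi> \<Delta> C M n w ! i)" if "i \<in> attention_bits C" for t i
      using that attention_bits_subset by (intro configuration_nth[OF \<open>k \<noteq> 0\<close> assms(1)]) blast
  qed
  then show ?thesis by (simp add: program_accepts_in_def attention_positions)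
qed

lemma program_accepts_imp:
  assumes "w \<in> worlds M" and "program_accepts_in program M w t"
  shows "\<exists>n. mpc_accepts_in Idn \<Pi> \<Delta> C M w n"
proof -
  have acc: "accepts_in (attention_bits C) (configuration program M w) t"
    using assms(2) by (simp add: program_accepts_in_def attention_positions)
  then have "k \<noteq> 0" using attention_bits_subset by (auto simp: accepts_in_def)
  show ?thesis unfolding mpc_accepts_in_def
  proof (rule accepts_in_slowedD[OF _ acc])
    show "configuration program M w t ! i =
        (\<exists>n. t div phase = Suc n \<and> mpc_state Idn \<Pi> \<Delta> C M n w ! i)" if "i \<in> attention_bits C" for t i
      using that attention_bits_subset by (intro configuration_nth[OF \<open>k \<noteq> 0\<close> assms(1)]) blast
  qed
qed

text \<open>All print bits lie below \<open>k\<close>, so the registers after the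
  \<open>State\<close> block do not contribute to the output.\<close>

lemma nths_configuration:
  assumes "k \<noteq> 0" and "w \<in> worlds M"
  shows "nths (configuration program M w (Suc n * phase)) (print_bits C) =
    nths (mpc_state Idn \<Pi> \<Delta> C M n w) (print_bits C)"
proof -
  let ?b = "configuration program M w (Suc n * phase)" and ?f = "mpc_state Idn \<Pi> \<Delta> C M n w"
  have "0 < phase" by (simp add: phase_def)
  have len: "length ?f = k"
    by (cases n) (simp_all add: circuit_fun_def state_length_def)
  have "k \<le> length ?b"
    using assms(1) length_registers by (simp add: program_def configuration_def reg_program_def)
  then have "take k ?b = ?f"
    using configuration_nth[OF assms] \<open>0 < phase\<close>
    by (intro nth_equalityI) (auto simp: len)
  then have "?b = ?f @ drop k ?b" by (metis append_take_drop_id)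
  moreover have "{j. j + length ?f \<in> print_bits C} = {}"
    using print_bits_subset len by auto
  ultimately show ?thesis by (metis append_Nil2 nths_append nths_empty)
qed

lemma program_output_eq:
  assumes w: "w \<in> worlds M"
  shows "program_output program M w = mpc_output Idn \<Pi> \<Delta> C M w"
proof (cases "\<exists>n. mpc_accepts_in Idn \<Pi> \<Delta> C M w n")
  case True
  then obtain n where n: "mpc_accepts_in Idn \<Pi> \<Delta> C M w n" by blast
  then have "k \<noteq> 0" using attention_bits_subset by (auto simp: mpc_accepts_in_def accepts_in_def)
  have "program_output program M w = Some (nths (configuration program M w (Suc n * phase)) (print_bits C))"
    using accepts_program[OF w n]
    by (simp only: program_output_def program_accepts_in_def attention_positions print_positions output_of_eq)
  moreover have "mpc_output Idn \<Pi> \<Delta> C M w = Some (nths (mpc_state Idn \<Pi> \<Delta> C M n w) (print_bits C))"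
    using n output_of_eq unfolding mpc_output_def mpc_accepts_in_def by fast
  ultimately show ?thesis using nths_configuration[OF \<open>k \<noteq> 0\<close> w] by simp
next
  case False
  then have "\<nexists>t. program_accepts_in program M w t" using program_accepts_imp[OF w] by blast
  then show ?thesis
    using False
    by (auto simp: program_output_def mpc_output_def output_of_def program_accepts_in_def mpc_accepts_in_def)
qed

text \<open>\<open>l < 2 ^ l\<close> bounds a phase by \<open>4 * (d + 2 ^ l)\<close>. The maximum
  is there because rounds are counted from 0: an output in round 0 still costs a full phase.\<close>

lemma computation_time: "Suc n * phase \<le> 8 * (d + 2 ^ l) * max 1 n"
proof -
  have "a + p + e + 2 \<le> 4 * (e + p)" if "a < p" for a p e :: nat
    using that by presburger
  then have "phase \<le> 4 * (d + 2 ^ l)" unfolding phase_def using less_exp by blast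
  moreover have "Suc n \<le> 2 * max 1 n" by simp
  ultimately have "Suc n * phase \<le> (2 * max 1 n) * (4 * (d + 2 ^ l))" by (rule mult_le_mono[rotated])
  moreover have "(2 * m) * (4 * z) = 8 * z * m" for m z :: nat by simp
  ultimately show ?thesis by (simp only:)
qed

end

theorem theorem5:
  fixes Idn :: "'p::{countable,infinite,linorder} set"
  shows "\<exists>translate :: 'p set \<Rightarrow> nat \<Rightarrow> 'g mpc \<Rightarrow> 'p program.
    (\<forall>\<Pi> \<Delta> C. finite \<Pi> \<and> is_mpc \<Pi> \<Delta> C \<longrightarrow>
       msc_program \<Pi> (translate \<Pi> \<Delta> C) \<and>
       equivalent TYPE('w) Idn \<Pi> \<Delta> C (translate \<Pi> \<Delta> C)) \<and>
    (\<forall>c. \<exists>K. \<forall>\<Pi> \<Delta> C. finite \<Pi> \<and> is_mpc \<Pi> \<Delta> C \<and> fan_in_bounded c (circ C) \<longrightarrow>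
       program_size (translate \<Pi> \<Delta> C) \<le> K * circuit_size (circ C)) \<and>
    (\<exists>K. \<forall>\<Pi> \<Delta> C. finite \<Pi> \<and> is_mpc \<Pi> \<Delta> C \<longrightarrow>
       (\<forall>M :: ('p, 'w) kripke. M \<in> model_class Idn \<Pi> \<Delta> \<longrightarrow>
          (\<forall>w\<in>worlds M. \<forall>n. mpc_accepts_in Idn \<Pi> \<Delta> C M w n \<longrightarrow>
             (\<exists>t. program_accepts_in (translate \<Pi> \<Delta> C) M w t \<and>
                  t \<le> K * (circuit_depth (circ C) + 2 ^ card (\<Pi> \<inter> Idn)) * max 1 n))))"
proof -
  \<comment> \<open>The construction depends on \<open>Idn\<close>, \<open>\<Pi>\<close>,
    \<open>\<Delta>\<close> and \<open>C\<close> but on no model, so one function serves all three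
    claims.\<close>
  define translate :: "'p set \<Rightarrow> nat \<Rightarrow> 'g mpc \<Rightarrow> 'p program" where
    "translate = translation.program Idn"
  have simulation: "mpc_simulation Idn \<Pi> \<Delta> C M"
    if "finite \<Pi> \<and> is_mpc \<Pi> \<Delta> C" and "M \<in> model_class Idn \<Pi> \<Delta>"
    for \<Pi> :: "'p set" and \<Delta> and C :: "'g mpc" and M :: "('p, 'w) kripke"
    using that by unfold_locales auto
  show ?thesis
  proof (intro exI[of _ translate] conjI allI impI)
    fix \<Pi> :: "'p set" and \<Delta> and C :: "'g mpc"
    assume C: "finite \<Pi> \<and> is_mpc \<Pi> \<Delta> C"
    then interpret mpc_translation Idn \<Pi> \<Delta> C by unfold_locales auto
    show "msc_program \<Pi> (translate \<Pi> \<Delta> C)"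
      using msc_program_program by (simp add: translate_def)
    show "equivalent TYPE('w) Idn \<Pi> \<Delta> C (translate \<Pi> \<Delta> C)"
      using mpc_simulation.program_output_eq[OF simulation[OF C]]
      by (simp add: equivalent_def translate_def)
  next
    fix c
    show "\<exists>K. \<forall>\<Pi> \<Delta> C. finite \<Pi> \<and> is_mpc \<Pi> \<Delta> C \<and> fan_in_bounded c (circ C) \<longrightarrow>
       program_size (translate \<Pi> \<Delta> C) \<le> K * circuit_size (circ C)"
      unfolding translate_def
      by (intro exI[of _ "8 * (3 * c + 54)"] allI impI mpc_translation.program_size_program)
        (auto simp: mpc_translation_def)
  next
    show "\<exists>K. \<forall>\<Pi> \<Delta> C. finite \<Pi> \<and> is_mpc \<Pi> \<Delta> C \<longrightarrow>
       (\<forall>M :: ('p, 'w) kripke. M \<in> model_class Idn \<Pi> \<Delta> \<longrightarrow>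
          (\<forall>w\<in>worlds M. \<forall>n. mpc_accepts_in Idn \<Pi> \<Delta> C M w n \<longrightarrow>
             (\<exists>t. program_accepts_in (translate \<Pi> \<Delta> C) M w t \<and>
                  t \<le> K * (circuit_depth (circ C) + 2 ^ card (\<Pi> \<inter> Idn)) * max 1 n)))"
      unfolding translate_def
      by (rule exI[of _ 8])
        (blast intro: mpc_simulation.accepts_program[OF simulation]
          mpc_simulation.computation_time[OF simulation])
  qed
qed

end
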